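(* For any semisimple MV-algebra $A$, $[0,1]_{\mathbb Q}\otimes A$ is (up to isomorphism) the divisible hull $A^d$ of $A$.
   Context: An MV-algebra is a structure $(A,\oplus,{}^*,0)$ such that $(A,\oplus,0)$ is an Abelian monoid, $(x^* )^*=x$, $(x^*\oplus y)^*\oplus y=(y^*\oplus x)^*\oplus x$ and $0^*\oplus x=0^*$; put $1=0^*$, $x\odot y=(x^*\oplus y^* )^*$, $x\vee y=(x\odot y^* )\oplus y$, $x\wedge y=(x\oplus y^* )\odot y$. The partial sum $x+y$ is defined iff $x\odot y=0$, and then $x+y=x\oplus y$. An MV-algebra is semisimple if the intersection $Rad$ of its maximal ideals is $\{0\}$; equivalently, it embeds in the MV-algebra $C(X)$ of continuous functions $X\to[0,1]$ (pointwise operations $x\oplus y=\min\{x+y,1\}$, $x^*=1-x$) for some compact Hausdorff space $X$. $[0,1]_{\mathbb Q}=[0,1]\cap\mathbb Q$ with $x\oplus y=\min\{x+y,1\}$, $x^*=1-x$. Divisible hull: if $A$ is semisimple and $A\subseteq C(X)$ with $X$ compact Hausdorff, then $A^d=\{a\in C(X)\mid a=\frac{a_1}{n}+\dots+\frac{a_n}{n}\text{ for some } n\in\mathbb N,\ n\ge1,\text{ and } a_1,\dots,a_n\in A\}$. Tensor product: a bimorphism $\beta:A\times B\to C$ of MV-algebras is a map with $\beta(1,1)=1$ that preserves $\vee,\wedge$ and (whenever defined) the partial sum $+$ in each argument separately. $A\otimes_{MV}B$ is the MV-algebra with a universal bimorphism from $A\times B$: every bimorphism $A\times B\to C$ factors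 uniquely through it by an MV-homomorphism. For semisimple $A,B$, $A\otimes B=(A\otimes_{MV}B)/Rad(A\otimes_{MV}B)$; it has the same universal property with respect to semisimple $C$. *)

theory Defs
  imports "HOL-Analysis.Analysis" "HOL-Algebra.Congruence"
begin

section \<open>MV-algebras\<close>

record 'a mv = "'a partial_object" +
  mv_plus :: "['a, 'a] \<Rightarrow> 'a" (infixl "\<oplus>\<index>" 65)
  mv_neg :: "'a \<Rightarrow> 'a" ("\<sim>\<index> _" [81] 80)
  mv_zero :: "'a" ("\<zero>\<index>")

definition mv_one :: "('a, 'm) mv_scheme \<Rightarrow> 'a" ("\<one>\<index>") where
  "\<one>\<^bsub>A\<^esub> = \<sim>\<^bsub>A\<^esub> \<zero>\<^bsub>A\<^esub>"

definition mv_times :: "('a, 'm) mv_scheme \<Rightarrow> 'a \<Rightarrow> 'a \<Rightarrow> 'a" (infixl "\<odot>\<index>" 70) where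
  "x \<odot>\<^bsub>A\<^esub> y = \<sim>\<^bsub>A\<^esub> (\<sim>\<^bsub>A\<^esub> x \<oplus>\<^bsub>A\<^esub> \<sim>\<^bsub>A\<^esub> y)"

definition mv_join :: "('a, 'm) mv_scheme \<Rightarrow> 'a \<Rightarrow> 'a \<Rightarrow> 'a" (infixl "\<squnion>\<index>" 65) where
  "x \<squnion>\<^bsub>A\<^esub> y = (x \<odot>\<^bsub>A\<^esub> \<sim>\<^bsub>A\<^esub> y) \<oplus>\<^bsub>A\<^esub> y"

definition mv_meet :: "('a, 'm) mv_scheme \<Rightarrow> 'a \<Rightarrow> 'a \<Rightarrow> 'a" (infixl "\<sqinter>\<index>" 70) where
  "x \<sqinter>\<^bsub>A\<^esub> y = (x \<oplus>\<^bsub>A\<^esub> \<sim>\<^bsub>A\<^esub> y) \<odot>\<^bsub>A\<^esub> y"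

locale mv_algebra =
  fixes A :: "('a, 'm) mv_scheme" (structure)
  assumes plus_closed: "\<lbrakk>x \<in> carrier A; y \<in> carrier A\<rbrakk> \<Longrightarrow> x \<oplus> y \<in> carrier A"
    and neg_closed: "x \<in> carrier A \<Longrightarrow> \<sim> x \<in> carrier A"
    and zero_closed: "\<zero> \<in> carrier A"
    and plus_assoc: "\<lbrakk>x \<in> carrier A; y \<in> carrier A; z \<in> carrier A\<rbrakk> \<Longrightarrow> (x \<oplus> y) \<oplus> z = x \<oplus> (y \<oplus> z)"
    and plus_comm: "\<lbrakk>x \<in> carrier A; y \<in> carrier A\<rbrakk> \<Longrightarrow> x \<oplus> y = y \<oplus> x"
    and plus_zero: "x \<in> carrier A \<Longrightarrow> x \<oplus> \<zero> = x"
    and neg_neg: "x \<in> carrier A \<Longrightarrow> \<sim> (\<sim> x) = x"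
    and lukasiewicz: "\<lbrakk>x \<in> carrier A; y \<in> carrier A\<rbrakk> \<Longrightarrow>
          \<sim> (\<sim> x \<oplus> y) \<oplus> y = \<sim> (\<sim> y \<oplus> x) \<oplus> x"
    and one_plus: "x \<in> carrier A \<Longrightarrow> \<sim> \<zero> \<oplus> x = \<sim> \<zero>"

definition mv_hom :: "('a, 'm) mv_scheme \<Rightarrow> ('b, 'n) mv_scheme \<Rightarrow> ('a \<Rightarrow> 'b) set" where
  "mv_hom A B = {h. h \<in> carrier A \<rightarrow> carrier B \<and>
     (\<forall>x\<in>carrier A. \<forall>y\<in>carrier A. h (x \<oplus>\<^bsub>A\<^esub> y) = h x \<oplus>\<^bsub>B\<^esub> h y) \<and>
     (\<forall>x\<in>carrier A. h (\<sim>\<^bsub>A\<^esub> x) = \<sim>\<^bsub>B\<^esub> (h x)) \<and> h \<zero>\<^bsub>A\<^esub> = \<zero>\<^bsub>B\<^esub>}"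

definition mv_isomorphic :: "('a, 'm) mv_scheme \<Rightarrow> ('b, 'n) mv_scheme \<Rightarrow> bool" where
  "mv_isomorphic A B \<longleftrightarrow> (\<exists>h\<in>mv_hom A B. bij_betw h (carrier A) (carrier B))"

definition mv_quotient :: "('a, 'm) mv_scheme \<Rightarrow> ('a \<times> 'a) set \<Rightarrow> 'a set mv" where
  "mv_quotient A R = \<lparr>carrier = carrier A // R,
     mv_plus = (\<lambda>X Y. \<Union>x\<in>X. \<Union>y\<in>Y. R `` {x \<oplus>\<^bsub>A\<^esub> y}),
     mv_neg = (\<lambda>X. \<Union>x\<in>X. R `` {\<sim>\<^bsub>A\<^esub> x}),
     mv_zero = R `` {\<zero>\<^bsub>A\<^esub>}\<rparr>"


section \<open>Ideals, radical, semisimplicity\<close>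

definition mv_le :: "('a, 'm) mv_scheme \<Rightarrow> 'a \<Rightarrow> 'a \<Rightarrow> bool" where
  "mv_le A x y \<longleftrightarrow> \<sim>\<^bsub>A\<^esub> x \<oplus>\<^bsub>A\<^esub> y = \<one>\<^bsub>A\<^esub>"

definition mv_ideal :: "('a, 'm) mv_scheme \<Rightarrow> 'a set \<Rightarrow> bool" where
  "mv_ideal A I \<longleftrightarrow> I \<subseteq> carrier A \<and> \<zero>\<^bsub>A\<^esub> \<in> I \<and>
     (\<forall>x\<in>I. \<forall>y\<in>I. x \<oplus>\<^bsub>A\<^esub> y \<in> I) \<and>
     (\<forall>y\<in>I. \<forall>x\<in>carrier A. mv_le A x y \<longrightarrow> x \<in> I)"

definition mv_maximal_ideal :: "('a, 'm) mv_scheme \<Rightarrow> 'a set \<Rightarrow> bool" where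
  "mv_maximal_ideal A M \<longleftrightarrow> mv_ideal A M \<and> M \<noteq> carrier A \<and>
     (\<forall>I. mv_ideal A I \<and> M \<subseteq> I \<longrightarrow> I = M \<or> I = carrier A)"

text \<open>The one-element algebra has no maximal ideal; its radical is the whole carrier, that is
  \<open>{0}\<close>, so it is semisimple (and it is \<open>C(X)\<close> for \<open>X\<close> empty).\<close>

definition mv_radical :: "('a, 'm) mv_scheme \<Rightarrow> 'a set" where
  "mv_radical A = {x \<in> carrier A. \<forall>M. mv_maximal_ideal A M \<longrightarrow> x \<in> M}"

definition mv_semisimple :: "('a, 'm) mv_scheme \<Rightarrow> bool" where
  "mv_semisimple A \<longleftrightarrow> mv_radical A = {\<zero>\<^bsub>A\<^esub>}"

text \<open>The congruence of an ideal \<open>I\<close>: the distance \<open>(x \<odot> y*) \<oplus> (y \<odot> x*)\<close> lies in \<open>I\<close>.\<close>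

definition mv_ideal_rel :: "('a, 'm) mv_scheme \<Rightarrow> 'a set \<Rightarrow> ('a \<times> 'a) set" where
  "mv_ideal_rel A I = {(x, y) \<in> carrier A \<times> carrier A.
     (x \<odot>\<^bsub>A\<^esub> \<sim>\<^bsub>A\<^esub> y) \<oplus>\<^bsub>A\<^esub> (y \<odot>\<^bsub>A\<^esub> \<sim>\<^bsub>A\<^esub> x) \<in> I}"


section \<open>Tensor products\<close>

text \<open>Preservation of the partial sum: if \<open>x + y\<close> is defined, that is \<open>x \<odot> y = 0\<close>, then
  \<open>f x + f y\<close> is defined and equal to \<open>f (x + y)\<close>.\<close>

definition mv_linear :: "('a, 'm) mv_scheme \<Rightarrow> ('c, 'n) mv_scheme \<Rightarrow> ('a \<Rightarrow> 'c) \<Rightarrow> bool" where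
  "mv_linear A C f \<longleftrightarrow> (\<forall>x\<in>carrier A. \<forall>y\<in>carrier A.
     f (x \<squnion>\<^bsub>A\<^esub> y) = f x \<squnion>\<^bsub>C\<^esub> f y \<and>
     f (x \<sqinter>\<^bsub>A\<^esub> y) = f x \<sqinter>\<^bsub>C\<^esub> f y \<and>
     (x \<odot>\<^bsub>A\<^esub> y = \<zero>\<^bsub>A\<^esub> \<longrightarrow>
        f x \<odot>\<^bsub>C\<^esub> f y = \<zero>\<^bsub>C\<^esub> \<and> f (x \<oplus>\<^bsub>A\<^esub> y) = f x \<oplus>\<^bsub>C\<^esub> f y))"

definition mv_bimorphism ::
  "('a, 'm) mv_scheme \<Rightarrow> ('b, 'n) mv_scheme \<Rightarrow> ('c, 'k) mv_scheme \<Rightarrow> ('a \<Rightarrow> 'b \<Rightarrow> 'c) \<Rightarrow> bool" where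
  "mv_bimorphism A B C \<beta> \<longleftrightarrow>
     (\<forall>a\<in>carrier A. \<forall>b\<in>carrier B. \<beta> a b \<in> carrier C) \<and>
     \<beta> \<one>\<^bsub>A\<^esub> \<one>\<^bsub>B\<^esub> = \<one>\<^bsub>C\<^esub> \<and>
     (\<forall>b\<in>carrier B. mv_linear A C (\<lambda>a. \<beta> a b)) \<and>
     (\<forall>a\<in>carrier A. mv_linear B C (\<lambda>b. \<beta> a b))"

text \<open>A universal property ranging over all MV-algebras \<open>C\<close> of all types cannot be a definition in
  HOL. The tensor product is therefore constructed, as the MV-algebra generated by \<open>A \<times> B\<close> subject
  to the relations of a bimorphism; the theorems \<open>mv_algebra_mv_tensor\<close>,
  \<open>mv_bimorphism_pure_tensor\<close> and \<open>mv_tensor_universal\<close> below show that it has the universal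
  property.\<close>

datatype 'g mv_term =
    Gen 'g | Plus "'g mv_term" "'g mv_term" | Neg "'g mv_term" | Zero

definition term_mv :: "'g set \<Rightarrow> 'g mv_term mv" where
  "term_mv G = \<lparr>carrier = {t. set_mv_term t \<subseteq> G}, mv_plus = Plus, mv_neg = Neg, mv_zero = Zero\<rparr>"

abbreviation tensor_terms ::
  "('a, 'm) mv_scheme \<Rightarrow> ('b, 'n) mv_scheme \<Rightarrow> ('a \<times> 'b) mv_term mv" where
  "tensor_terms A B \<equiv> term_mv (carrier A \<times> carrier B)"

inductive_set tensor_rel ::
  "('a, 'm) mv_scheme \<Rightarrow> ('b, 'n) mv_scheme \<Rightarrow> (('a \<times> 'b) mv_term \<times> ('a \<times> 'b) mv_term) set"
  for A :: "('a, 'm) mv_scheme" and B :: "('b, 'n) mv_scheme"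
  where
  refl: "t \<in> carrier (tensor_terms A B) \<Longrightarrow> (t, t) \<in> tensor_rel A B"
| sym: "(s, t) \<in> tensor_rel A B \<Longrightarrow> (t, s) \<in> tensor_rel A B"
| trans: "\<lbrakk>(s, t) \<in> tensor_rel A B; (t, u) \<in> tensor_rel A B\<rbrakk> \<Longrightarrow> (s, u) \<in> tensor_rel A B"
| cong_plus: "\<lbrakk>(s, s') \<in> tensor_rel A B; (t, t') \<in> tensor_rel A B\<rbrakk> \<Longrightarrow>
    (Plus s t, Plus s' t') \<in> tensor_rel A B"
| cong_neg: "(s, s') \<in> tensor_rel A B \<Longrightarrow> (Neg s, Neg s') \<in> tensor_rel A B"

| assoc: "\<lbrakk>s \<in> carrier (tensor_terms A B); t \<in> carrier (tensor_terms A B);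
      u \<in> carrier (tensor_terms A B)\<rbrakk> \<Longrightarrow>
    (Plus (Plus s t) u, Plus s (Plus t u)) \<in> tensor_rel A B"
| comm: "\<lbrakk>s \<in> carrier (tensor_terms A B); t \<in> carrier (tensor_terms A B)\<rbrakk> \<Longrightarrow>
    (Plus s t, Plus t s) \<in> tensor_rel A B"
| unit: "s \<in> carrier (tensor_terms A B) \<Longrightarrow> (Plus s Zero, s) \<in> tensor_rel A B"
| invol: "s \<in> carrier (tensor_terms A B) \<Longrightarrow> (Neg (Neg s), s) \<in> tensor_rel A B"
| luk: "\<lbrakk>s \<in> carrier (tensor_terms A B); t \<in> carrier (tensor_terms A B)\<rbrakk> \<Longrightarrow>
    (Plus (Neg (Plus (Neg s) t)) t, Plus (Neg (Plus (Neg t) s)) s) \<in> tensor_rel A B"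
| absorb: "s \<in> carrier (tensor_terms A B) \<Longrightarrow>
    (Plus (Neg Zero) s, Neg Zero) \<in> tensor_rel A B"

| bi_one: "(Gen (\<one>\<^bsub>A\<^esub>, \<one>\<^bsub>B\<^esub>), \<one>\<^bsub>tensor_terms A B\<^esub>) \<in> tensor_rel A B"
| join1: "\<lbrakk>a \<in> carrier A; a' \<in> carrier A; b \<in> carrier B\<rbrakk> \<Longrightarrow>
    (Gen (a \<squnion>\<^bsub>A\<^esub> a', b), Gen (a, b) \<squnion>\<^bsub>tensor_terms A B\<^esub> Gen (a', b)) \<in> tensor_rel A B"
| meet1: "\<lbrakk>a \<in> carrier A; a' \<in> carrier A; b \<in> carrier B\<rbrakk> \<Longrightarrow>
    (Gen (a \<sqinter>\<^bsub>A\<^esub> a', b), Gen (a, b) \<sqinter>\<^bsub>tensor_terms A B\<^esub> Gen (a', b)) \<in> tensor_rel A B"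
| orth1: "\<lbrakk>a \<in> carrier A; a' \<in> carrier A; b \<in> carrier B; a \<odot>\<^bsub>A\<^esub> a' = \<zero>\<^bsub>A\<^esub>\<rbrakk> \<Longrightarrow>
    (Gen (a, b) \<odot>\<^bsub>tensor_terms A B\<^esub> Gen (a', b), Zero) \<in> tensor_rel A B"
| plus1: "\<lbrakk>a \<in> carrier A; a' \<in> carrier A; b \<in> carrier B; a \<odot>\<^bsub>A\<^esub> a' = \<zero>\<^bsub>A\<^esub>\<rbrakk> \<Longrightarrow>
    (Gen (a \<oplus>\<^bsub>A\<^esub> a', b), Plus (Gen (a, b)) (Gen (a', b))) \<in> tensor_rel A B"
| join2: "\<lbrakk>a \<in> carrier A; b \<in> carrier B; b' \<in> carrier B\<rbrakk> \<Longrightarrow>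
    (Gen (a, b \<squnion>\<^bsub>B\<^esub> b'), Gen (a, b) \<squnion>\<^bsub>tensor_terms A B\<^esub> Gen (a, b')) \<in> tensor_rel A B"
| meet2: "\<lbrakk>a \<in> carrier A; b \<in> carrier B; b' \<in> carrier B\<rbrakk> \<Longrightarrow>
    (Gen (a, b \<sqinter>\<^bsub>B\<^esub> b'), Gen (a, b) \<sqinter>\<^bsub>tensor_terms A B\<^esub> Gen (a, b')) \<in> tensor_rel A B"
| orth2: "\<lbrakk>a \<in> carrier A; b \<in> carrier B; b' \<in> carrier B; b \<odot>\<^bsub>B\<^esub> b' = \<zero>\<^bsub>B\<^esub>\<rbrakk> \<Longrightarrow>
    (Gen (a, b) \<odot>\<^bsub>tensor_terms A B\<^esub> Gen (a, b'), Zero) \<in> tensor_rel A B"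
| plus2: "\<lbrakk>a \<in> carrier A; b \<in> carrier B; b' \<in> carrier B; b \<odot>\<^bsub>B\<^esub> b' = \<zero>\<^bsub>B\<^esub>\<rbrakk> \<Longrightarrow>
    (Gen (a, b \<oplus>\<^bsub>B\<^esub> b'), Plus (Gen (a, b)) (Gen (a, b'))) \<in> tensor_rel A B"

definition mv_tensor ::
  "('a, 'm) mv_scheme \<Rightarrow> ('b, 'n) mv_scheme \<Rightarrow> ('a \<times> 'b) mv_term set mv" where
  "mv_tensor A B = mv_quotient (tensor_terms A B) (tensor_rel A B)"

definition pure_tensor ::
  "('a, 'm) mv_scheme \<Rightarrow> ('b, 'n) mv_scheme \<Rightarrow> 'a \<Rightarrow> 'b \<Rightarrow> ('a \<times> 'b) mv_term set" where
  "pure_tensor A B a b = tensor_rel A B `` {Gen (a, b)}"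

definition semisimple_tensor ::
  "('a, 'm) mv_scheme \<Rightarrow> ('b, 'n) mv_scheme \<Rightarrow> ('a \<times> 'b) mv_term set set mv" where
  "semisimple_tensor A B =
     mv_quotient (mv_tensor A B) (mv_ideal_rel (mv_tensor A B) (mv_radical (mv_tensor A B)))"


subsection \<open>The universal property\<close>

lemma term_mv_simps [simp]:
  "mv_plus (term_mv G) = Plus" "mv_neg (term_mv G) = Neg" "mv_zero (term_mv G) = Zero"
  "Gen g \<in> carrier (term_mv G) \<longleftrightarrow> g \<in> G"
  "Plus s t \<in> carrier (term_mv G) \<longleftrightarrow> s \<in> carrier (term_mv G) \<and> t \<in> carrier (term_mv G)"
  "Neg s \<in> carrier (term_mv G) \<longleftrightarrow> s \<in> carrier (term_mv G)"
  "Zero \<in> carrier (term_mv G)"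
  by (auto simp: term_mv_def)

context mv_algebra
begin

lemma one_closed: "\<one> \<in> carrier A"
  by (simp add: mv_one_def neg_closed zero_closed)

lemma times_closed: "\<lbrakk>x \<in> carrier A; y \<in> carrier A\<rbrakk> \<Longrightarrow> x \<odot> y \<in> carrier A"
  by (simp add: mv_times_def neg_closed plus_closed)

lemma join_closed: "\<lbrakk>x \<in> carrier A; y \<in> carrier A\<rbrakk> \<Longrightarrow> x \<squnion> y \<in> carrier A"
  by (simp add: mv_join_def times_closed neg_closed plus_closed)

lemma meet_closed: "\<lbrakk>x \<in> carrier A; y \<in> carrier A\<rbrakk> \<Longrightarrow> x \<sqinter> y \<in> carrier A"
  by (simp add: mv_meet_def times_closed neg_closed plus_closed)

lemmas closed = plus_closed neg_closed zero_closed one_closed times_closed join_closed meet_closed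

end

lemma tensor_rel_carrier:
  assumes "mv_algebra A" "mv_algebra B" "(s, t) \<in> tensor_rel A B"
  shows "s \<in> carrier (tensor_terms A B) \<and> t \<in> carrier (tensor_terms A B)"
proof -
  interpret A: mv_algebra A by fact
  interpret B: mv_algebra B by fact
  show ?thesis using assms(3)
    by induction
      (auto simp: A.closed B.closed mv_join_def[of "term_mv _"] mv_meet_def[of "term_mv _"]
        mv_times_def[of "term_mv _"] mv_one_def[of "term_mv _"])
qed

lemma equiv_tensor_rel:
  assumes "mv_algebra A" "mv_algebra B"
  shows "equiv (carrier (tensor_terms A B)) (tensor_rel A B)"
  using tensor_rel_carrier[OF assms]
  by (intro equivI refl_onI symI transI) (auto intro: tensor_rel.refl tensor_rel.sym tensor_rel.trans)

context
  fixes A :: "('a, 'm) mv_scheme" and B :: "('b, 'n) mv_scheme"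
  assumes A: "mv_algebra A" and B: "mv_algebra B"
begin

interpretation A: mv_algebra A by (fact A)
interpretation B: mv_algebra B by (fact B)

private abbreviation "F \<equiv> tensor_terms A B"
private abbreviation "R \<equiv> tensor_rel A B"
private abbreviation "T \<equiv> mv_tensor A B"
private abbreviation "cls t \<equiv> R `` {t}"

private lemmas EQ = equiv_tensor_rel[OF A B]

private lemma cls_eqI: "(s, t) \<in> R \<Longrightarrow> cls s = cls t"
  using EQ by (rule equiv_class_eq)

private lemma cls_mem: "t \<in> carrier F \<Longrightarrow> t \<in> cls t"
  using EQ by (rule equiv_class_self)

private lemma carrier_T: "carrier T = carrier F // R"
  by (simp add: mv_tensor_def mv_quotient_def)

private lemma cls_closed: "t \<in> carrier F \<Longrightarrow> cls t \<in> carrier T"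
  by (simp add: carrier_T quotientI)

private lemma cls_E:
  assumes "X \<in> carrier T" obtains t where "t \<in> carrier F" "X = cls t"
  using assms unfolding carrier_T by (auto elim: quotientE)

private lemma cls_zero: "\<zero>\<^bsub>T\<^esub> = cls Zero"
  by (simp add: mv_tensor_def mv_quotient_def)

private lemma cls_neg: "t \<in> carrier F \<Longrightarrow> \<sim>\<^bsub>T\<^esub> (cls t) = cls (Neg t)"
proof -
  assume t: "t \<in> carrier F"
  have "cls (Neg x) = cls (Neg t)" if "x \<in> cls t" for x
    using that by (auto intro!: cls_eqI tensor_rel.cong_neg intro: tensor_rel.sym)
  then have "(\<Union>x\<in>cls t. cls (Neg x)) = cls (Neg t)"
    by (intro UN_constant_eq[OF cls_mem[OF t]] ballI)
  then show ?thesis by (simp add: mv_tensor_def mv_quotient_def)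
qed

private lemma cls_plus:
  assumes s: "s \<in> carrier F" and t: "t \<in> carrier F"
  shows "cls s \<oplus>\<^bsub>T\<^esub> cls t = cls (Plus s t)"
proof -
  have "cls (Plus x y) = cls (Plus s t)" if "x \<in> cls s" "y \<in> cls t" for x y
    using that by (auto intro!: cls_eqI tensor_rel.cong_plus intro: tensor_rel.sym)
  then have "(\<Union>y\<in>cls t. cls (Plus x y)) = cls (Plus s t)" if "x \<in> cls s" for x
    using that by (intro UN_constant_eq[OF cls_mem[OF t]] ballI)
  then have "(\<Union>x\<in>cls s. \<Union>y\<in>cls t. cls (Plus x y)) = cls (Plus s t)"
    by (intro UN_constant_eq[OF cls_mem[OF s]] ballI)
  then show ?thesis by (simp add: mv_tensor_def mv_quotient_def)
qed

private lemma cls_one: "\<one>\<^bsub>T\<^esub> = cls \<one>\<^bsub>F\<^esub>"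
  by (simp add: mv_one_def cls_zero cls_neg)

private lemma cls_times:
  assumes "s \<in> carrier F" "t \<in> carrier F"
  shows "cls s \<odot>\<^bsub>T\<^esub> cls t = cls (s \<odot>\<^bsub>F\<^esub> t)"
  using assms by (simp add: mv_times_def cls_neg cls_plus)

private lemma times_F: "s \<in> carrier F \<Longrightarrow> t \<in> carrier F \<Longrightarrow> s \<odot>\<^bsub>F\<^esub> t \<in> carrier F"
  by (simp add: mv_times_def)

private lemma cls_join:
  assumes "s \<in> carrier F" "t \<in> carrier F"
  shows "cls s \<squnion>\<^bsub>T\<^esub> cls t = cls (s \<squnion>\<^bsub>F\<^esub> t)"
  using assms by (simp add: mv_join_def cls_neg cls_plus cls_times times_F)

private lemma cls_meet:
  assumes "s \<in> carrier F" "t \<in> carrier F"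
  shows "cls s \<sqinter>\<^bsub>T\<^esub> cls t = cls (s \<sqinter>\<^bsub>F\<^esub> t)"
  using assms by (simp add: mv_meet_def cls_neg cls_plus cls_times times_F)

private lemma F_closed:
  assumes "s \<in> carrier F" "t \<in> carrier F"
  shows "s \<squnion>\<^bsub>F\<^esub> t \<in> carrier F" "s \<sqinter>\<^bsub>F\<^esub> t \<in> carrier F" "s \<odot>\<^bsub>F\<^esub> t \<in> carrier F"
    "\<one>\<^bsub>F\<^esub> \<in> carrier F"
  using assms by (simp_all add: mv_join_def mv_meet_def mv_times_def mv_one_def)

theorem mv_algebra_mv_tensor: "mv_algebra (mv_tensor A B)"
  by unfold_locales
    (auto elim!: cls_E simp: cls_zero cls_neg cls_plus cls_closed
      intro!: cls_eqI tensor_rel.assoc tensor_rel.comm tensor_rel.unit tensor_rel.invol tensor_rel.luk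
        tensor_rel.absorb del: equalityI)

theorem mv_bimorphism_pure_tensor: "mv_bimorphism A B (mv_tensor A B) (pure_tensor A B)"
  unfolding mv_bimorphism_def mv_linear_def pure_tensor_def
  by (auto simp: cls_zero cls_one cls_plus cls_times cls_join cls_meet cls_closed
        F_closed A.closed B.closed
      intro: cls_eqI tensor_rel.bi_one tensor_rel.join1 tensor_rel.meet1 tensor_rel.orth1 tensor_rel.plus1
        tensor_rel.join2 tensor_rel.meet2 tensor_rel.orth2 tensor_rel.plus2 del: equalityI)

private primrec ev :: "('c, 'k) mv_scheme \<Rightarrow> ('a \<Rightarrow> 'b \<Rightarrow> 'c) \<Rightarrow> ('a \<times> 'b) mv_term \<Rightarrow> 'c" where
  "ev C \<beta> (Gen g) = \<beta> (fst g) (snd g)"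
| "ev C \<beta> (Plus s t) = ev C \<beta> s \<oplus>\<^bsub>C\<^esub> ev C \<beta> t"
| "ev C \<beta> (Neg s) = \<sim>\<^bsub>C\<^esub> (ev C \<beta> s)"
| "ev C \<beta> Zero = \<zero>\<^bsub>C\<^esub>"

theorem mv_tensor_universal:
  fixes C :: "('c, 'k) mv_scheme"
  assumes C: "mv_algebra C" and \<beta>: "mv_bimorphism A B C \<beta>"
  shows "\<exists>h\<in>mv_hom (mv_tensor A B) C.
           (\<forall>a\<in>carrier A. \<forall>b\<in>carrier B. h (pure_tensor A B a b) = \<beta> a b) \<and>
           (\<forall>h'\<in>mv_hom (mv_tensor A B) C.
              (\<forall>a\<in>carrier A. \<forall>b\<in>carrier B. h' (pure_tensor A B a b) = \<beta> a b) \<longrightarrow>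
              (\<forall>x\<in>carrier (mv_tensor A B). h' x = h x))"
proof -
  interpret C: mv_algebra C by (fact C)
  let ?e = "ev C \<beta>"
  have e_closed: "?e t \<in> carrier C" if "t \<in> carrier F" for t
    using that
  proof (induction t)
    case (Gen g)
    then show ?case using \<beta> by (cases g) (auto simp: mv_bimorphism_def)
  qed (auto intro: C.closed)
  have e_ops: "?e (s \<odot>\<^bsub>F\<^esub> t) = ?e s \<odot>\<^bsub>C\<^esub> ?e t" "?e (s \<squnion>\<^bsub>F\<^esub> t) = ?e s \<squnion>\<^bsub>C\<^esub> ?e t"
    "?e (s \<sqinter>\<^bsub>F\<^esub> t) = ?e s \<sqinter>\<^bsub>C\<^esub> ?e t" "?e \<one>\<^bsub>F\<^esub> = \<one>\<^bsub>C\<^esub>" for s t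
    by (simp_all add: mv_times_def mv_join_def mv_meet_def mv_one_def)
  have e_rel: "?e s = ?e t" if "(s, t) \<in> R" for s t
    using that
  proof induction
    case (assoc s t u)
    then show ?case by (simp add: e_closed C.plus_assoc)
  next
    case (comm s t)
    then show ?case by (simp add: e_closed C.plus_comm)
  next
    case (luk s t)
    then show ?case by (simp add: e_closed C.lukasiewicz)
  qed (use \<beta> in \<open>auto simp: mv_bimorphism_def mv_linear_def e_ops e_closed
         C.plus_zero C.neg_neg C.one_plus\<close>)
  define h where "h X = ?e (SOME t. t \<in> X)" for X
  have h_cls: "h (cls t) = ?e t" if "t \<in> carrier F" for t
  proof -
    have "(SOME u. u \<in> cls t) \<in> cls t"
      using cls_mem[OF that] by (rule someI)
    then show ?thesis
      unfolding h_def using e_rel by (metis Image_singleton_iff)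
  qed
  have "h \<in> mv_hom T C"
    unfolding mv_hom_def
    by (auto elim!: cls_E simp: cls_zero cls_neg cls_plus h_cls e_closed)
  moreover have "h (pure_tensor A B a b) = \<beta> a b" if "a \<in> carrier A" "b \<in> carrier B" for a b
    using that by (simp add: pure_tensor_def h_cls)
  moreover have "h' x = h x"
    if h': "h' \<in> mv_hom T C" and
      g: "\<forall>a\<in>carrier A. \<forall>b\<in>carrier B. h' (pure_tensor A B a b) = \<beta> a b" and
      x: "x \<in> carrier T" for h' x
  proof -
    have h'_plus: "h' (X \<oplus>\<^bsub>T\<^esub> Y) = h' X \<oplus>\<^bsub>C\<^esub> h' Y" if "X \<in> carrier T" "Y \<in> carrier T" for X Y
      using h' that by (simp add: mv_hom_def)
    have h'_neg: "h' (\<sim>\<^bsub>T\<^esub> X) = \<sim>\<^bsub>C\<^esub> (h' X)" if "X \<in> carrier T" for X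
      using h' that by (simp add: mv_hom_def)
    have "h' (cls t) = ?e t" if "t \<in> carrier F" for t
      using that
    proof (induction t)
      case (Gen p)
      then show ?case using g by (cases p) (auto simp: pure_tensor_def)
    next
      case (Plus s t)
      then show ?case using h'_plus[of "cls s" "cls t"] by (simp add: cls_closed cls_plus)
    next
      case (Neg s)
      then show ?case using h'_neg[of "cls s"] by (simp add: cls_closed cls_neg)
    next
      case Zero
      then show ?case using h' by (simp add: mv_hom_def cls_zero)
    qed
    with x show ?thesis by (auto elim!: cls_E simp: h_cls)
  qed
  ultimately show ?thesis by blast
qed

end


section \<open>Rational unit interval, function algebras, divisible hull\<close>

definition rat_unit_mv :: "real mv" where
  "rat_unit_mv = \<lparr>carrier = {0..1} \<inter> \<rat>, mv_plus = (\<lambda>x y. min (x + y) 1),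
     mv_neg = (\<lambda>x. 1 - x), mv_zero = 0\<rparr>"

text \<open>\<open>C(X)\<close>: functions are taken to be \<open>undefined\<close> outside \<open>X\<close>, so that equality is equality
  on \<open>X\<close>.\<close>

definition cont_mv :: "'x topology \<Rightarrow> ('x \<Rightarrow> real) mv" where
  "cont_mv X = \<lparr>carrier = {f \<in> extensional (topspace X).
                   continuous_map X (top_of_set {0..1}) f},
     mv_plus = (\<lambda>f g. \<lambda>x\<in>topspace X. min (f x + g x) 1),
     mv_neg = (\<lambda>f. \<lambda>x\<in>topspace X. 1 - f x),
     mv_zero = (\<lambda>x\<in>topspace X. 0)\<rparr>"

definition mv_representation ::
  "('a, 'm) mv_scheme \<Rightarrow> 'x topology \<Rightarrow> ('a \<Rightarrow> 'x \<Rightarrow> real) \<Rightarrow> bool" where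
  "mv_representation A X e \<longleftrightarrow> compact_space X \<and> Hausdorff_space X \<and>
     e \<in> mv_hom A (cont_mv X) \<and> inj_on e (carrier A)"

text \<open>The divisible hull in \<open>C(X)\<close> of a subset \<open>S\<close> (a subalgebra) of \<open>C(X)\<close>. The partial sums
  \<open>a\<^sub>1/n + ... + a\<^sub>n/n\<close> are always defined in \<open>C(X)\<close> and are the pointwise sums of reals.\<close>

definition divisible_hull :: "'x topology \<Rightarrow> ('x \<Rightarrow> real) set \<Rightarrow> ('x \<Rightarrow> real) mv" where
  "divisible_hull X S = (cont_mv X) \<lparr>carrier :=
     {a \<in> carrier (cont_mv X). \<exists>n\<ge>1. \<exists>b :: nat \<Rightarrow> 'x \<Rightarrow> real.
        (\<forall>i\<in>{1..n}. b i \<in> S) \<and> (\<forall>x\<in>topspace X. a x = (\<Sum>i=1..n. b i x / real n))}\<rparr>"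

end

(*
  A bimorphism from [0,1]_Q x A to [0,1] has the form (q, a) |-> q * psi(a) for a homomorphism
  psi : A -> [0,1]. By Hoelder's theorem for MV-chains the maximal ideals of an MV-algebra are
  exactly the kernels of its homomorphisms to [0,1], and by compactness every homomorphism from a
  subalgebra of C(X) to [0,1] is evaluation at a point. So the map of the tensor product onto the
  divisible hull induced by (q, a) |-> q * a vanishes exactly where all homomorphisms to [0,1]
  vanish, that is, on the radical.
*)
theory Submission
  imports Defs
begin

text \<open>The tensor product is a quotient of terms, so neither its elements nor its ideals can be
  inspected directly; what can be controlled are homomorphisms out of it, through the universal
  property. Hence maximal ideals are traded for homomorphisms to the real interval: composed with
  pure tensors these become bimorphisms, and uniqueness in the universal property identifies them
  with evaluation at a point after the induced map. Rationality forces the factor q, since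
  additivity alone gives \<open>\<beta> (m/n) a = m * \<beta> (1/n) a\<close>. In the second
  argument a bimorphism respects only defined sums, yet \<open>a \<oplus> b\<close> is always the
  defined sum of \<open>a\<close> and \<open>b \<sqinter> \<sim> a\<close>, which makes psi a
  homomorphism. For Hoelder's theorem the positive cone of Chang's group is enough; it is coded by
  integer and fractional parts that are added with a carry. For the hull the difficulty is that a
  member needs exactly n summands while sums and multiples produce other numbers of them; cutting a
  sum into slices between consecutive integers restores the count.\<close>

section \<open>Arithmetic in MV-algebras\<close>

context mv_algebra
begin

declare closed [simp]

abbreviation le (infix "\<preceq>" 50) where "x \<preceq> y \<equiv> mv_le A x y"

lemma plus_left_comm:
  "\<lbrakk>x \<in> carrier A; y \<in> carrier A; z \<in> carrier A\<rbrakk> \<Longrightarrow> x \<oplus> (y \<oplus> z) = y \<oplus> (x \<oplus> z)"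
  by (metis plus_assoc plus_comm)

lemmas plus_ac = plus_assoc plus_comm plus_left_comm

lemma neg_one [simp]: "\<sim> \<one> = \<zero>"
  by (simp add: mv_one_def neg_neg)

lemma neg_zero [simp]: "\<sim> \<zero> = \<one>"
  by (simp add: mv_one_def)

lemma one_plus' [simp]: "x \<in> carrier A \<Longrightarrow> \<one> \<oplus> x = \<one>"
  using one_plus[of x] by simp

lemma plus_one [simp]: "x \<in> carrier A \<Longrightarrow> x \<oplus> \<one> = \<one>"
  by (simp add: plus_comm[of x])

lemma zero_plus [simp]: "x \<in> carrier A \<Longrightarrow> \<zero> \<oplus> x = x"
  by (simp add: plus_comm[of _ x] plus_zero)

declare plus_zero [simp] neg_neg [simp]

lemma neg_plus_self [simp]: "x \<in> carrier A \<Longrightarrow> \<sim> x \<oplus> x = \<one>"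
  using lukasiewicz[of x \<one>] by simp

lemma plus_neg_self [simp]: "x \<in> carrier A \<Longrightarrow> x \<oplus> \<sim> x = \<one>"
  by (simp add: plus_comm[of x])

lemma neg_inject: "\<lbrakk>x \<in> carrier A; y \<in> carrier A\<rbrakk> \<Longrightarrow> \<sim> x = \<sim> y \<longleftrightarrow> x = y"
  by (metis neg_neg)

lemma neg_times: "\<lbrakk>x \<in> carrier A; y \<in> carrier A\<rbrakk> \<Longrightarrow> \<sim> (x \<odot> y) = \<sim> x \<oplus> \<sim> y"
  by (simp add: mv_times_def)

lemma neg_plus: "\<lbrakk>x \<in> carrier A; y \<in> carrier A\<rbrakk> \<Longrightarrow> \<sim> (x \<oplus> y) = \<sim> x \<odot> \<sim> y"
  by (simp add: mv_times_def)

lemma times_comm: "\<lbrakk>x \<in> carrier A; y \<in> carrier A\<rbrakk> \<Longrightarrow> x \<odot> y = y \<odot> x"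
  by (simp add: mv_times_def plus_comm)

lemma times_assoc:
  "\<lbrakk>x \<in> carrier A; y \<in> carrier A; z \<in> carrier A\<rbrakk> \<Longrightarrow> (x \<odot> y) \<odot> z = x \<odot> (y \<odot> z)"
  by (simp add: mv_times_def plus_assoc)

lemma times_left_comm:
  "\<lbrakk>x \<in> carrier A; y \<in> carrier A; z \<in> carrier A\<rbrakk> \<Longrightarrow> x \<odot> (y \<odot> z) = y \<odot> (x \<odot> z)"
  by (metis times_assoc times_comm)

lemmas times_ac = times_assoc times_comm times_left_comm

lemma times_one [simp]: "x \<in> carrier A \<Longrightarrow> x \<odot> \<one> = x"
  and times_zero [simp]: "x \<in> carrier A \<Longrightarrow> x \<odot> \<zero> = \<zero>"
  and times_neg_self [simp]: "x \<in> carrier A \<Longrightarrow> x \<odot> \<sim> x = \<zero>"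
  and zero_times [simp]: "x \<in> carrier A \<Longrightarrow> \<zero> \<odot> x = \<zero>"
  by (simp_all add: mv_times_def)

section \<open>Order, residuation and lattice operations\<close>

lemma le_iff_times: "\<lbrakk>x \<in> carrier A; y \<in> carrier A\<rbrakk> \<Longrightarrow> x \<preceq> y \<longleftrightarrow> x \<odot> \<sim> y = \<zero>"
  unfolding mv_le_def mv_times_def by (metis neg_closed neg_neg neg_one neg_zero plus_closed)

lemma times_eq_zero_iff: "\<lbrakk>x \<in> carrier A; y \<in> carrier A\<rbrakk> \<Longrightarrow> x \<odot> y = \<zero> \<longleftrightarrow> x \<preceq> \<sim> y"
  by (simp add: le_iff_times)

lemma plus_eq_one_iff: "\<lbrakk>x \<in> carrier A; y \<in> carrier A\<rbrakk> \<Longrightarrow> x \<oplus> y = \<one> \<longleftrightarrow> \<sim> x \<preceq> y"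
  by (simp add: mv_le_def)

lemma le_refl [simp]: "x \<in> carrier A \<Longrightarrow> x \<preceq> x"
  and zero_le [simp]: "x \<in> carrier A \<Longrightarrow> \<zero> \<preceq> x"
  and le_one [simp]: "x \<in> carrier A \<Longrightarrow> x \<preceq> \<one>"
  by (simp_all add: mv_le_def)

lemma join_comm: "\<lbrakk>x \<in> carrier A; y \<in> carrier A\<rbrakk> \<Longrightarrow> x \<squnion> y = y \<squnion> x"
  using lukasiewicz by (simp add: mv_join_def mv_times_def)

lemma le_join_eq: "\<lbrakk>x \<in> carrier A; y \<in> carrier A; x \<preceq> y\<rbrakk> \<Longrightarrow> x \<squnion> y = y"
  by (simp add: mv_join_def le_iff_times)

lemma le_antisym: "\<lbrakk>x \<preceq> y; y \<preceq> x; x \<in> carrier A; y \<in> carrier A\<rbrakk> \<Longrightarrow> x = y"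
  by (metis join_comm le_join_eq)

lemma le_plus [simp]: "\<lbrakk>x \<in> carrier A; y \<in> carrier A\<rbrakk> \<Longrightarrow> x \<preceq> x \<oplus> y"
  by (simp add: mv_le_def plus_assoc[symmetric])

lemma le_plus' [simp]: "\<lbrakk>x \<in> carrier A; y \<in> carrier A\<rbrakk> \<Longrightarrow> x \<preceq> y \<oplus> x"
  using le_plus plus_comm by metis

lemma le_split: "\<lbrakk>x \<preceq> y; x \<in> carrier A; y \<in> carrier A\<rbrakk> \<Longrightarrow> (y \<odot> \<sim> x) \<oplus> x = y"
  using le_join_eq[of x y] join_comm[of x y] by (simp add: mv_join_def)

lemma le_trans [trans]:
  assumes "x \<preceq> y" "y \<preceq> z" and [simp]: "x \<in> carrier A" "y \<in> carrier A" "z \<in> carrier A"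
  shows "x \<preceq> z"
proof -
  have "z = (z \<odot> \<sim> y) \<oplus> ((y \<odot> \<sim> x) \<oplus> x)"
    using assms by (simp add: le_split)
  then show ?thesis by (metis assms(3-5) le_plus' neg_closed plus_assoc plus_closed times_closed)
qed

lemma neg_le_iff: "\<lbrakk>x \<in> carrier A; y \<in> carrier A\<rbrakk> \<Longrightarrow> \<sim> x \<preceq> \<sim> y \<longleftrightarrow> y \<preceq> x"
  by (simp add: mv_le_def plus_comm)

lemma plus_mono_left:
  assumes "x \<preceq> y" and [simp]: "x \<in> carrier A" "y \<in> carrier A" "z \<in> carrier A"
  shows "x \<oplus> z \<preceq> y \<oplus> z"
  using le_plus'[of "x \<oplus> z" "y \<odot> \<sim> x"] le_split[OF assms(1-3)]
  by (simp add: plus_assoc[symmetric])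

lemma plus_mono:
  assumes "x \<preceq> y" "z \<preceq> w"
    and [simp]: "x \<in> carrier A" "y \<in> carrier A" "z \<in> carrier A" "w \<in> carrier A"
  shows "x \<oplus> z \<preceq> y \<oplus> w"
  using plus_mono_left[of x y z] plus_mono_left[of z w y] assms le_trans[of "x \<oplus> z" "y \<oplus> z" "y \<oplus> w"]
  by (simp add: plus_comm)

lemma times_mono:
  assumes "x \<preceq> y" "z \<preceq> w"
    and [simp]: "x \<in> carrier A" "y \<in> carrier A" "z \<in> carrier A" "w \<in> carrier A"
  shows "x \<odot> z \<preceq> y \<odot> w"
  unfolding mv_times_def using assms by (simp add: neg_le_iff plus_mono)

lemma times_le [simp]: "\<lbrakk>x \<in> carrier A; y \<in> carrier A\<rbrakk> \<Longrightarrow> x \<odot> y \<preceq> x"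
  using times_mono[of x x y \<one>] by simp

lemma times_le' [simp]: "\<lbrakk>x \<in> carrier A; y \<in> carrier A\<rbrakk> \<Longrightarrow> y \<odot> x \<preceq> x"
  using times_le times_comm by metis

lemma residuation:
  "\<lbrakk>x \<in> carrier A; y \<in> carrier A; z \<in> carrier A\<rbrakk> \<Longrightarrow> x \<odot> y \<preceq> z \<longleftrightarrow> x \<preceq> \<sim> y \<oplus> z"
  by (simp add: mv_le_def neg_times plus_assoc)

lemma residuation_neg:
  "\<lbrakk>x \<in> carrier A; y \<in> carrier A; z \<in> carrier A\<rbrakk> \<Longrightarrow> x \<odot> \<sim> y \<preceq> z \<longleftrightarrow> x \<preceq> y \<oplus> z"
  by (simp add: residuation)

lemma le_join2: "\<lbrakk>x \<in> carrier A; y \<in> carrier A\<rbrakk> \<Longrightarrow> y \<preceq> x \<squnion> y"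
  by (simp add: mv_join_def)

lemma le_join1: "\<lbrakk>x \<in> carrier A; y \<in> carrier A\<rbrakk> \<Longrightarrow> x \<preceq> x \<squnion> y"
  by (metis join_comm le_join2)

lemma join_least:
  assumes "x \<preceq> z" "y \<preceq> z" and [simp]: "x \<in> carrier A" "y \<in> carrier A" "z \<in> carrier A"
  shows "x \<squnion> y \<preceq> z"
proof -
  have "(x \<odot> \<sim> y) \<oplus> y \<preceq> (z \<odot> \<sim> y) \<oplus> y"
    using assms by (intro plus_mono times_mono) auto
  then show ?thesis using le_split[of y z] assms by (simp add: mv_join_def)
qed

lemma neg_meet: "\<lbrakk>x \<in> carrier A; y \<in> carrier A\<rbrakk> \<Longrightarrow> \<sim> (x \<sqinter> y) = \<sim> x \<squnion> \<sim> y"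
  by (simp add: mv_join_def mv_meet_def neg_times neg_plus)

lemma meet_comm: "\<lbrakk>x \<in> carrier A; y \<in> carrier A\<rbrakk> \<Longrightarrow> x \<sqinter> y = y \<sqinter> x"
  by (metis neg_meet join_comm neg_inject meet_closed neg_closed)

lemma meet_le1: "\<lbrakk>x \<in> carrier A; y \<in> carrier A\<rbrakk> \<Longrightarrow> x \<sqinter> y \<preceq> x"
  by (metis neg_meet le_join1 neg_le_iff meet_closed neg_closed)

lemma meet_le2: "\<lbrakk>x \<in> carrier A; y \<in> carrier A\<rbrakk> \<Longrightarrow> x \<sqinter> y \<preceq> y"
  by (metis meet_comm meet_le1)

lemma meet_greatest:
  assumes "z \<preceq> x" "z \<preceq> y" and [simp]: "x \<in> carrier A" "y \<in> carrier A" "z \<in> carrier A"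
  shows "z \<preceq> x \<sqinter> y"
  using join_least[of "\<sim> x" "\<sim> z" "\<sim> y"] assms neg_le_iff[of "x \<sqinter> y" z]
  by (simp add: neg_meet neg_le_iff)

text \<open>Residuation moves \<open>w\<close> to the left: \<open>t \<odot> \<sim> w\<close> lies
  below \<open>v\<close> and \<open>z\<close>, hence below their meet. This is the half of
  distributivity of \<oplus> over meets that monotonicity does not give.\<close>

lemma le_plus_meet:
  assumes "t \<preceq> w \<oplus> v" "t \<preceq> w \<oplus> z"
    and [simp]: "t \<in> carrier A" "w \<in> carrier A" "v \<in> carrier A" "z \<in> carrier A"
  shows "t \<preceq> w \<oplus> (v \<sqinter> z)"
  using assms residuation_neg[of t w] meet_greatest[of "t \<odot> \<sim> w" v z] by simp

text \<open>Turns any sum into a defined one: \<open>y \<sqinter> \<sim> x\<close> is the part of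
  \<open>y\<close> for which there is room above \<open>x\<close>. The point is that
  \<open>x \<oplus> y\<close> lies below both \<open>x \<oplus> y\<close> and
  \<open>x \<oplus> \<sim> x = \<one>\<close>.\<close>

lemma plus_neg_meet:
  assumes [simp]: "x \<in> carrier A" "y \<in> carrier A"
  shows "x \<oplus> (y \<sqinter> \<sim> x) = x \<oplus> y"
  using le_plus_meet[of "x \<oplus> y" x y "\<sim> x"]
    plus_mono[OF le_refl meet_le1, of x y "\<sim> x"]
  by (intro le_antisym) auto

text \<open>Two rounds of \<open>le_plus_meet\<close>, one per summand. Needed to see that the
  elements whose meet with a fixed \<open>z\<close> lies in an ideal are closed under sums.\<close>

lemma meet_plus_le:
  assumes [simp]: "x \<in> carrier A" "y \<in> carrier A" "z \<in> carrier A"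
  shows "(x \<oplus> y) \<sqinter> z \<preceq> (x \<sqinter> z) \<oplus> (y \<sqinter> z)"
proof -
  let ?t = "(x \<oplus> y) \<sqinter> z"
  have t: "?t \<preceq> x \<oplus> y" "?t \<preceq> z"
    by (simp_all add: meet_le1 meet_le2)
  have "?t \<preceq> y \<oplus> (x \<sqinter> z)"
    using t le_trans[of ?t z "y \<oplus> z"] by (intro le_plus_meet) (auto simp: plus_comm)
  moreover have "?t \<preceq> (x \<sqinter> z) \<oplus> z"
    using t le_trans[of ?t z "(x \<sqinter> z) \<oplus> z"] by simp
  ultimately show ?thesis
    by (intro le_plus_meet) (auto simp: plus_comm)
qed

text \<open>Cancellation for defined sums: the left side is by definition the meet of
  \<open>x\<close> and \<open>\<sim> y\<close>.\<close>

lemma diff_eq: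
  assumes "x \<preceq> \<sim> y" and [simp]: "x \<in> carrier A" "y \<in> carrier A"
  shows "(x \<oplus> y) \<odot> \<sim> y = x"
proof -
  have "x = (x \<oplus> y) \<odot> \<sim> y"
    using le_antisym[of x "x \<sqinter> \<sim> y"] assms meet_greatest[of x x "\<sim> y"] meet_le1[of x "\<sim> y"]
    by (simp add: mv_meet_def)
  then show ?thesis by simp
qed

text \<open>A common lower bound \<open>t\<close> of the two differences can be added to
  \<open>x \<sqinter> y\<close> without passing \<open>x\<close> or \<open>y\<close>; so the sum is
  still below \<open>x \<sqinter> y\<close>, and cancellation makes \<open>t\<close> vanish. Modulo
  a maximal ideal this disjointness becomes totality of the order.\<close>

lemma prelinear:
  assumes t: "t \<preceq> x \<odot> \<sim> y" "t \<preceq> y \<odot> \<sim> x"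
    and [simp]: "t \<in> carrier A" "x \<in> carrier A" "y \<in> carrier A"
  shows "t = \<zero>"
proof -
  let ?z = "x \<sqinter> y"
  have z: "?z \<preceq> x" "?z \<preceq> y" by (simp_all add: meet_le1 meet_le2)
  have "x \<odot> \<sim> y \<preceq> x \<odot> \<sim> ?z" "y \<odot> \<sim> x \<preceq> y \<odot> \<sim> ?z"
    using z by (auto intro!: times_mono simp: neg_le_iff)
  then have t': "t \<preceq> x \<odot> \<sim> ?z" "t \<preceq> y \<odot> \<sim> ?z"
    using t le_trans[of t "x \<odot> \<sim> y"] le_trans[of t "y \<odot> \<sim> x"] by simp_all
  have "t \<oplus> ?z \<preceq> x" "t \<oplus> ?z \<preceq> y"
    using plus_mono_left[OF t'(1), of ?z] plus_mono_left[OF t'(2), of ?z] z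
    by (simp_all add: le_split)
  then have "t \<oplus> ?z \<preceq> ?z" by (intro meet_greatest) auto
  then have "(t \<oplus> ?z) \<odot> \<sim> ?z \<preceq> \<zero>"
    by (simp add: residuation_neg)
  moreover have "t \<preceq> \<sim> ?z"
    using t'(1) le_trans[of t "x \<odot> \<sim> ?z" "\<sim> ?z"] by simp
  ultimately have "t \<preceq> \<zero>" by (simp add: diff_eq)
  then show ?thesis by (intro le_antisym) auto
qed

text \<open>Enlarging \<open>x\<close> and \<open>z\<close> to their joins with \<open>y\<close> and
  \<open>w\<close> splits each into a difference plus the part to be subtracted. Together with
  \<open>diff_triangle\<close> this makes the relation of an ideal a congruence.\<close>

lemma diff_plus_le:
  assumes [simp]: "x \<in> carrier A" "y \<in> carrier A" "z \<in> carrier A" "w \<in> carrier A"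
  shows "(x \<oplus> z) \<odot> \<sim> (y \<oplus> w) \<preceq> (x \<odot> \<sim> y) \<oplus> (z \<odot> \<sim> w)"
proof -
  have "x \<oplus> z \<preceq> (x \<squnion> y) \<oplus> (z \<squnion> w)"
    by (intro plus_mono) (auto simp: le_join1)
  then show ?thesis
    by (simp add: residuation_neg mv_join_def plus_ac)
qed

lemma diff_triangle:
  assumes [simp]: "x \<in> carrier A" "y \<in> carrier A" "z \<in> carrier A"
  shows "x \<odot> \<sim> z \<preceq> (x \<odot> \<sim> y) \<oplus> (y \<odot> \<sim> z)"
proof -
  have "x \<preceq> (x \<odot> \<sim> y) \<oplus> y" using le_join1[of x y] by (simp add: mv_join_def)
  moreover have "(x \<odot> \<sim> y) \<oplus> y \<preceq> (x \<odot> \<sim> y) \<oplus> ((y \<odot> \<sim> z) \<oplus> z)"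
    using le_join1[of y z] by (intro plus_mono) (auto simp: mv_join_def)
  ultimately have "x \<preceq> (x \<odot> \<sim> y) \<oplus> ((y \<odot> \<sim> z) \<oplus> z)"
    by (rule le_trans) auto
  then show ?thesis by (simp add: residuation_neg plus_ac)
qed

lemma dist_eq_zero_iff:
  assumes [simp]: "x \<in> carrier A" "y \<in> carrier A"
  shows "(x \<odot> \<sim> y) \<oplus> (y \<odot> \<sim> x) = \<zero> \<longleftrightarrow> x = y"
proof
  assume "(x \<odot> \<sim> y) \<oplus> (y \<odot> \<sim> x) = \<zero>"
  then have "x \<odot> \<sim> y \<preceq> \<zero>" "y \<odot> \<sim> x \<preceq> \<zero>"
    using le_plus[of "x \<odot> \<sim> y" "y \<odot> \<sim> x"] le_plus'[of "y \<odot> \<sim> x" "x \<odot> \<sim> y"] by simp_all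
  then show "x = y" by (intro le_antisym) (auto simp: residuation_neg)
qed simp

end

section \<open>Homomorphisms, subalgebras, quotients\<close>

lemma mv_homD:
  assumes "h \<in> mv_hom A B"
  shows "x \<in> carrier A \<Longrightarrow> h x \<in> carrier B"
    and "\<lbrakk>x \<in> carrier A; y \<in> carrier A\<rbrakk> \<Longrightarrow> h (x \<oplus>\<^bsub>A\<^esub> y) = h x \<oplus>\<^bsub>B\<^esub> h y"
    and "x \<in> carrier A \<Longrightarrow> h (\<sim>\<^bsub>A\<^esub> x) = \<sim>\<^bsub>B\<^esub> (h x)"
    and "h \<zero>\<^bsub>A\<^esub> = \<zero>\<^bsub>B\<^esub>"
  using assms by (auto simp: mv_hom_def)

lemma mv_hom_derived:
  assumes "mv_algebra A" and h: "h \<in> mv_hom A B"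
  shows "h \<one>\<^bsub>A\<^esub> = \<one>\<^bsub>B\<^esub>"
    and "\<lbrakk>x \<in> carrier A; y \<in> carrier A\<rbrakk> \<Longrightarrow> h (x \<odot>\<^bsub>A\<^esub> y) = h x \<odot>\<^bsub>B\<^esub> h y"
    and "\<lbrakk>x \<in> carrier A; y \<in> carrier A\<rbrakk> \<Longrightarrow> h (x \<squnion>\<^bsub>A\<^esub> y) = h x \<squnion>\<^bsub>B\<^esub> h y"
    and "\<lbrakk>x \<in> carrier A; y \<in> carrier A\<rbrakk> \<Longrightarrow> h (x \<sqinter>\<^bsub>A\<^esub> y) = h x \<sqinter>\<^bsub>B\<^esub> h y"
proof -
  interpret mv_algebra A by fact
  show one: "h \<one>\<^bsub>A\<^esub> = \<one>\<^bsub>B\<^esub>"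
    by (simp add: mv_one_def mv_homD[OF h] del: neg_zero)
  have times: "h (x \<odot>\<^bsub>A\<^esub> y) = h x \<odot>\<^bsub>B\<^esub> h y" if "x \<in> carrier A" "y \<in> carrier A" for x y
    using that by (simp add: mv_times_def mv_homD[OF h])
  show "h (x \<odot>\<^bsub>A\<^esub> y) = h x \<odot>\<^bsub>B\<^esub> h y" "h (x \<squnion>\<^bsub>A\<^esub> y) = h x \<squnion>\<^bsub>B\<^esub> h y"
    "h (x \<sqinter>\<^bsub>A\<^esub> y) = h x \<sqinter>\<^bsub>B\<^esub> h y" if "x \<in> carrier A" "y \<in> carrier A"
    using that by (simp_all add: times mv_join_def mv_meet_def mv_homD[OF h])
qed

lemma mv_hom_compose:
  assumes "f \<in> mv_hom A B" "g \<in> mv_hom B C"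
  shows "g \<circ> f \<in> mv_hom A C"
  using assms by (auto simp: mv_hom_def Pi_iff)

lemma mv_bimorphism_compose:
  assumes "mv_algebra C" "mv_bimorphism A B C \<beta>" and h: "h \<in> mv_hom C D"
  shows "mv_bimorphism A B D (\<lambda>a b. h (\<beta> a b))"
proof -
  interpret C: mv_algebra C by fact
  note hh = mv_homD[OF h] mv_hom_derived[OF assms(1) h]
  show ?thesis
    using assms(2) unfolding mv_bimorphism_def mv_linear_def by (auto simp flip: hh simp: hh(1))
qed

lemma mv_algebra_subalgebra:
  assumes "mv_algebra A" and "S \<subseteq> carrier A" "\<zero>\<^bsub>A\<^esub> \<in> S"
    and "\<And>x. x \<in> S \<Longrightarrow> \<sim>\<^bsub>A\<^esub> x \<in> S" "\<And>x y. x \<in> S \<Longrightarrow> y \<in> S \<Longrightarrow> x \<oplus>\<^bsub>A\<^esub> y \<in> S"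
  shows "mv_algebra (A\<lparr>carrier := S\<rparr>)"
proof -
  interpret mv_algebra A by fact
  have "x \<in> carrier A" if "x \<in> S" for x using that assms(2) by blast
  then show ?thesis
    using assms(3-5) lukasiewicz by unfold_locales (auto simp: plus_ac)
qed

text \<open>Serves two quotients: by the congruence of a homomorphism's kernel, and by that of a
  maximal ideal on the way to Hoelder's theorem.\<close>

locale mv_congruence = mv_algebra A for A :: "('a, 'm) mv_scheme" (structure) +
  fixes R :: "('a \<times> 'a) set"
  assumes equiv: "equiv (carrier A) R"
    and cong_plus: "\<lbrakk>(x, x') \<in> R; (y, y') \<in> R\<rbrakk> \<Longrightarrow> (x \<oplus> y, x' \<oplus> y') \<in> R"
    and cong_neg: "(x, x') \<in> R \<Longrightarrow> (\<sim> x, \<sim> x') \<in> R"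
begin

abbreviation "Q \<equiv> mv_quotient A R"
abbreviation "cls x \<equiv> R `` {x}"

lemma cls_eq_iff: "\<lbrakk>x \<in> carrier A; y \<in> carrier A\<rbrakk> \<Longrightarrow> cls x = cls y \<longleftrightarrow> (x, y) \<in> R"
  using equiv by (simp add: eq_equiv_class_iff)

lemma cls_mem: "x \<in> carrier A \<Longrightarrow> x \<in> cls x"
  using equiv by (rule equiv_class_self)

lemma cls_memD: "y \<in> cls x \<Longrightarrow> y \<in> carrier A \<and> (x, y) \<in> R \<and> (y, x) \<in> R"
  using equiv by (auto simp: equiv_def sym_def refl_on_def)

lemma cls_closed: "x \<in> carrier A \<Longrightarrow> cls x \<in> carrier Q"
  by (simp add: mv_quotient_def quotientI)

lemma cls_E:
  assumes "X \<in> carrier Q" obtains x where "x \<in> carrier A" "X = cls x"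
  using assms by (auto simp: mv_quotient_def elim: quotientE)

lemma cls_zero: "\<zero>\<^bsub>Q\<^esub> = cls \<zero>"
  by (simp add: mv_quotient_def)

lemma cls_neg: "x \<in> carrier A \<Longrightarrow> \<sim>\<^bsub>Q\<^esub> (cls x) = cls (\<sim> x)"
proof -
  assume x: "x \<in> carrier A"
  have "cls (\<sim> y) = cls (\<sim> x)" if "y \<in> cls x" for y
    using cls_memD[OF that] x by (simp add: cls_eq_iff cong_neg)
  then have "(\<Union>y\<in>cls x. cls (\<sim> y)) = cls (\<sim> x)"
    by (intro UN_constant_eq[OF cls_mem[OF x]] ballI)
  then show ?thesis by (simp add: mv_quotient_def)
qed

lemma cls_plus:
  assumes x: "x \<in> carrier A" and y: "y \<in> carrier A"
  shows "cls x \<oplus>\<^bsub>Q\<^esub> cls y = cls (x \<oplus> y)"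
proof -
  have "cls (x' \<oplus> y') = cls (x \<oplus> y)" if "x' \<in> cls x" "y' \<in> cls y" for x' y'
    using cls_memD[OF that(1)] cls_memD[OF that(2)] x y by (simp add: cls_eq_iff cong_plus)
  then have "(\<Union>y'\<in>cls y. cls (x' \<oplus> y')) = cls (x \<oplus> y)" if "x' \<in> cls x" for x'
    using that by (intro UN_constant_eq[OF cls_mem[OF y]] ballI)
  then have "(\<Union>x'\<in>cls x. \<Union>y'\<in>cls y. cls (x' \<oplus> y')) = cls (x \<oplus> y)"
    by (intro UN_constant_eq[OF cls_mem[OF x]] ballI)
  then show ?thesis by (simp add: mv_quotient_def)
qed

lemma mv_algebra_quotient: "mv_algebra Q"
proof
  fix X Y assume "X \<in> carrier Q" "Y \<in> carrier Q"
  then obtain x y where "x \<in> carrier A" "X = cls x" "y \<in> carrier A" "Y = cls y"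
    by (elim cls_E)
  then show "\<sim>\<^bsub>Q\<^esub> (\<sim>\<^bsub>Q\<^esub> X \<oplus>\<^bsub>Q\<^esub> Y) \<oplus>\<^bsub>Q\<^esub> Y = \<sim>\<^bsub>Q\<^esub> (\<sim>\<^bsub>Q\<^esub> Y \<oplus>\<^bsub>Q\<^esub> X) \<oplus>\<^bsub>Q\<^esub> X"
    "X \<oplus>\<^bsub>Q\<^esub> Y = Y \<oplus>\<^bsub>Q\<^esub> X"
    using lukasiewicz[of x y] plus_comm[of x y] by (simp_all add: cls_neg cls_plus)
qed (auto elim!: cls_E simp: cls_zero cls_neg cls_plus cls_closed plus_assoc)

lemma cls_hom: "cls \<in> mv_hom A Q"
  by (auto simp: mv_hom_def cls_closed cls_zero cls_neg cls_plus)

end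

lemma mv_isomorphic_quotient:
  assumes "mv_algebra T" and D: "mv_algebra D" and h: "h \<in> mv_hom T D"
    and surj: "h ` carrier T = carrier D"
    and I: "I = {x \<in> carrier T. h x = \<zero>\<^bsub>D\<^esub>}"
  shows "mv_isomorphic (mv_quotient T (mv_ideal_rel T I)) D"
proof -
  interpret T: mv_algebra T by fact
  interpret D: mv_algebra D by fact
  note hh = mv_homD[OF h] mv_hom_derived[OF assms(1) h]
  let ?R = "mv_ideal_rel T I"
  \<comment> \<open>The distance of \<open>h x\<close> and \<open>h y\<close> is zero only if they
    are equal, so the relation of the kernel is equality of values.\<close>
  have R: "?R = {(x, y) \<in> carrier T \<times> carrier T. h x = h y}"
    unfolding mv_ideal_rel_def I by (auto simp: hh D.dist_eq_zero_iff)
  interpret mv_congruence T ?R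
    unfolding R by unfold_locales (auto intro!: equivI simp: refl_on_def sym_def trans_def hh)
  define g where "g X = h (SOME x. x \<in> X)" for X
  have g: "g (cls x) = h x" if "x \<in> carrier T" for x
  proof -
    have "(SOME y. y \<in> cls x) \<in> cls x" using cls_mem[OF that] by (rule someI)
    then show ?thesis unfolding g_def by (auto simp: R)
  qed
  have "g \<in> mv_hom Q D"
    unfolding mv_hom_def by (auto elim!: cls_E simp: cls_zero cls_neg cls_plus g hh)
  moreover have "inj_on g (carrier Q)"
  proof (rule inj_onI)
    fix X Y assume "X \<in> carrier Q" "Y \<in> carrier Q" "g X = g Y"
    moreover obtain x y where "x \<in> carrier T" "X = cls x" "y \<in> carrier T" "Y = cls y"
      using calculation(1,2) by (elim cls_E)
    ultimately show "X = Y" by (auto simp: g cls_eq_iff) (auto simp: R)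
  qed
  moreover have "g ` carrier Q = carrier D"
  proof -
    have "carrier Q = cls ` carrier T" by (auto elim!: cls_E intro: cls_closed)
    then show ?thesis using surj by (simp add: image_image g cong: image_cong)
  qed
  ultimately show ?thesis unfolding mv_isomorphic_def bij_betw_def by blast
qed

section \<open>Function algebras\<close>

text \<open>The target must contain irrationals: the slopes that Hoelder's theorem assigns to
  elements of a chain need not be rational.\<close>

definition unit_mv :: "real mv" where
  "unit_mv = \<lparr>carrier = {0..1}, mv_plus = (\<lambda>x y. min (x + y) 1),
     mv_neg = (\<lambda>x. 1 - x), mv_zero = 0\<rparr>"

lemma unit_mv_simps [simp]:
  "carrier unit_mv = {0..1}" "x \<oplus>\<^bsub>unit_mv\<^esub> y = min (x + y) 1" "\<sim>\<^bsub>unit_mv\<^esub> x = 1 - x"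
  "\<zero>\<^bsub>unit_mv\<^esub> = 0"
  by (simp_all add: unit_mv_def)

lemma unit_mv_derived [simp]:
  "\<one>\<^bsub>unit_mv\<^esub> = 1" "x \<odot>\<^bsub>unit_mv\<^esub> y = max 0 (x + y - 1)"
  "\<lbrakk>x \<le> 1; y \<le> 1\<rbrakk> \<Longrightarrow> x \<squnion>\<^bsub>unit_mv\<^esub> y = max x y"
  "\<lbrakk>0 \<le> x; 0 \<le> y\<rbrakk> \<Longrightarrow> x \<sqinter>\<^bsub>unit_mv\<^esub> y = min x y"
  by (auto simp: mv_one_def mv_times_def mv_join_def mv_meet_def)

lemma mv_algebra_unit_mv: "mv_algebra unit_mv"
  by unfold_locales auto

lemma rat_unit_mv_simps [simp]:
  "carrier rat_unit_mv = {0..1} \<inter> \<rat>" "x \<oplus>\<^bsub>rat_unit_mv\<^esub> y = min (x + y) 1"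
  "\<sim>\<^bsub>rat_unit_mv\<^esub> x = 1 - x" "\<zero>\<^bsub>rat_unit_mv\<^esub> = 0"
  by (simp_all add: rat_unit_mv_def)

lemma rat_unit_mv_derived [simp]:
  "\<one>\<^bsub>rat_unit_mv\<^esub> = 1" "x \<odot>\<^bsub>rat_unit_mv\<^esub> y = max 0 (x + y - 1)"
  "\<lbrakk>x \<le> 1; y \<le> 1\<rbrakk> \<Longrightarrow> x \<squnion>\<^bsub>rat_unit_mv\<^esub> y = max x y"
  "\<lbrakk>0 \<le> x; 0 \<le> y\<rbrakk> \<Longrightarrow> x \<sqinter>\<^bsub>rat_unit_mv\<^esub> y = min x y"
  by (auto simp: mv_one_def mv_times_def mv_join_def mv_meet_def)

lemma mv_algebra_rat_unit_mv: "mv_algebra rat_unit_mv"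
  by unfold_locales (auto simp: min_def)

lemma cont_mv_simps [simp]:
  "f \<oplus>\<^bsub>cont_mv X\<^esub> g = (\<lambda>x\<in>topspace X. min (f x + g x) 1)"
  "\<sim>\<^bsub>cont_mv X\<^esub> f = (\<lambda>x\<in>topspace X. 1 - f x)"
  "\<zero>\<^bsub>cont_mv X\<^esub> = (\<lambda>x\<in>topspace X. 0)"
  by (simp_all add: cont_mv_def)

lemma cont_mv_derived [simp]:
  "\<one>\<^bsub>cont_mv X\<^esub> = (\<lambda>x\<in>topspace X. 1)"
  "f \<odot>\<^bsub>cont_mv X\<^esub> g = (\<lambda>x\<in>topspace X. max 0 (f x + g x - 1))"
  by (auto simp: mv_one_def mv_times_def fun_eq_iff)

lemma mem_cont_mv_iff:
  "f \<in> carrier (cont_mv X) \<longleftrightarrow>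
     f \<in> extensional (topspace X) \<and> continuous_map X euclideanreal f \<and> (\<forall>x\<in>topspace X. 0 \<le> f x \<and> f x \<le> 1)"
  by (auto simp: cont_mv_def continuous_map_in_subtopology Pi_iff image_subset_iff)

lemma cont_mv_lattice:
  assumes "f \<in> carrier (cont_mv X)" "g \<in> carrier (cont_mv X)"
  shows "f \<squnion>\<^bsub>cont_mv X\<^esub> g = (\<lambda>x\<in>topspace X. max (f x) (g x))"
    "f \<sqinter>\<^bsub>cont_mv X\<^esub> g = (\<lambda>x\<in>topspace X. min (f x) (g x))"
  using assms by (auto simp: mem_cont_mv_iff mv_join_def mv_meet_def fun_eq_iff restrict_def min_def max_def)

lemma restrict_mem_cont_mv:
  assumes "continuous_map X euclideanreal f" "\<And>x. x \<in> topspace X \<Longrightarrow> 0 \<le> f x \<and> f x \<le> 1"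
  shows "restrict f (topspace X) \<in> carrier (cont_mv X)"
  using assms by (auto simp: mem_cont_mv_iff intro: continuous_map_eq[of X euclideanreal f])

lemma mv_algebra_cont_mv: "mv_algebra (cont_mv X)"
proof
  fix f g assume "f \<in> carrier (cont_mv X)" "g \<in> carrier (cont_mv X)"
  then show "f \<oplus>\<^bsub>cont_mv X\<^esub> g \<in> carrier (cont_mv X)"
    unfolding cont_mv_simps
    by (intro restrict_mem_cont_mv) (auto simp: mem_cont_mv_iff intro!: continuous_intros)
next
  fix f assume "f \<in> carrier (cont_mv X)"
  then show "\<sim>\<^bsub>cont_mv X\<^esub> f \<in> carrier (cont_mv X)"
    unfolding cont_mv_simps
    by (intro restrict_mem_cont_mv) (auto simp: mem_cont_mv_iff intro!: continuous_intros)
next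
  show "\<zero>\<^bsub>cont_mv X\<^esub> \<in> carrier (cont_mv X)"
    unfolding cont_mv_simps by (intro restrict_mem_cont_mv) auto
qed (auto simp: mem_cont_mv_iff fun_eq_iff restrict_def extensional_def min_def)

lemma eval_cont_mv_hom: "x \<in> topspace X \<Longrightarrow> (\<lambda>f. f x) \<in> mv_hom (cont_mv X) unit_mv"
  by (auto simp: mv_hom_def mem_cont_mv_iff)

section \<open>Ideals and MV-chains\<close>

context mv_algebra
begin

lemma mv_idealD:
  assumes "mv_ideal A I"
  shows "x \<in> I \<Longrightarrow> x \<in> carrier A" "\<zero> \<in> I" "\<lbrakk>x \<in> I; y \<in> I\<rbrakk> \<Longrightarrow> x \<oplus> y \<in> I"
    "\<lbrakk>x \<preceq> y; y \<in> I; x \<in> carrier A\<rbrakk> \<Longrightarrow> x \<in> I"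
  using assms unfolding mv_ideal_def by blast+

lemma mv_ideal_rel_iff:
  assumes I: "mv_ideal A I" and [simp]: "x \<in> carrier A" "y \<in> carrier A"
  shows "(x, y) \<in> mv_ideal_rel A I \<longleftrightarrow> x \<odot> \<sim> y \<in> I \<and> y \<odot> \<sim> x \<in> I"
proof -
  have "x \<odot> \<sim> y \<in> I \<and> y \<odot> \<sim> x \<in> I" if "(x \<odot> \<sim> y) \<oplus> (y \<odot> \<sim> x) \<in> I"
    using mv_idealD(4)[OF I _ that] by simp
  then show ?thesis
    using mv_idealD(3)[OF I] by (auto simp: mv_ideal_rel_def)
qed

lemma mv_congruence_ideal:
  assumes I: "mv_ideal A I"
  shows "mv_congruence A (mv_ideal_rel A I)"
proof -
  let ?R = "mv_ideal_rel A I"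
  note iff = mv_ideal_rel_iff[OF I]
  have car: "x \<in> carrier A \<and> y \<in> carrier A" if "(x, y) \<in> ?R" for x y
    using that by (auto simp: mv_ideal_rel_def)
  have mem: "x \<in> I" if "x \<preceq> y \<oplus> z" "y \<in> I" "z \<in> I" "x \<in> carrier A" for x y z
    using that mv_idealD(4)[OF I that(1) mv_idealD(3)[OF I that(2,3)]] by simp
  show ?thesis
  proof
    show "equiv (carrier A) ?R"
    proof (rule equivI)
      show "?R \<subseteq> carrier A \<times> carrier A" by (auto simp: mv_ideal_rel_def)
      show "refl_on (carrier A) ?R" by (auto simp: refl_on_def iff mv_idealD[OF I])
      show "sym ?R" by (rule symI) (metis car iff)
      show "trans ?R"
      proof (rule transI)
        fix x y z assume xy: "(x, y) \<in> ?R" and yz: "(y, z) \<in> ?R"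
        then have [simp]: "x \<in> carrier A" "y \<in> carrier A" "z \<in> carrier A"
          using car by auto
        show "(x, z) \<in> ?R"
          using xy yz mem[OF diff_triangle[of x y z]] mem[OF diff_triangle[of z y x]] by (simp add: iff)
      qed
    qed
  next
    fix x x' y y' assume xx: "(x, x') \<in> ?R" and yy: "(y, y') \<in> ?R"
    then have [simp]: "x \<in> carrier A" "y \<in> carrier A" "x' \<in> carrier A" "y' \<in> carrier A"
      using car by auto
    show "(x \<oplus> y, x' \<oplus> y') \<in> ?R"
      using xx yy mem[OF diff_plus_le[of x x' y y']] mem[OF diff_plus_le[of x' x y' y]]
      by (simp add: iff)
  next
    fix x x' assume xx: "(x, x') \<in> ?R"
    then have "x \<in> carrier A" "x' \<in> carrier A" using car by auto
    then show "(\<sim> x, \<sim> x') \<in> ?R" using xx by (simp add: iff times_comm)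
  qed
qed

text \<open>If \<open>z = x \<odot> \<sim> y\<close> is not in \<open>M\<close>, then \<open>{u. u \<sqinter> z \<in> M}\<close> is a proper ideal above \<open>M\<close>, hence
  equal to \<open>M\<close>; it contains \<open>y \<odot> \<sim> x\<close> because \<open>(x \<odot> \<sim> y) \<sqinter> (y \<odot> \<sim> x) = \<zero>\<close>.\<close>

lemma maximal_ideal_prime:
  assumes M: "mv_maximal_ideal A M" and [simp]: "x \<in> carrier A" "y \<in> carrier A"
  shows "x \<odot> \<sim> y \<in> M \<or> y \<odot> \<sim> x \<in> M"
proof (cases "x \<odot> \<sim> y \<in> M")
  case z: False
  let ?z = "x \<odot> \<sim> y" and ?w = "y \<odot> \<sim> x"
  let ?I = "{u \<in> carrier A. u \<sqinter> ?z \<in> M}"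
  have I: "mv_ideal A M" using M by (simp add: mv_maximal_ideal_def)
  note MD = mv_idealD[OF I]
  have meet0: "t \<sqinter> ?z = \<zero>" if "t \<preceq> ?w" "t \<in> carrier A" for t
  proof (rule prelinear[of _ x y])
    show "t \<sqinter> ?z \<preceq> ?z" using that by (simp add: meet_le2)
    show "t \<sqinter> ?z \<preceq> ?w" using le_trans[OF meet_le1[of t ?z] that(1)] that(2) by simp
  qed (use that in auto)
  have "mv_ideal A ?I"
    unfolding mv_ideal_def
  proof (intro conjI ballI impI)
    show "\<zero> \<in> ?I" using meet0[of \<zero>] MD(2) by simp
  next
    fix u v assume u: "u \<in> ?I" and v: "v \<in> ?I"
    then have "(u \<oplus> v) \<sqinter> ?z \<preceq> (u \<sqinter> ?z) \<oplus> (v \<sqinter> ?z)" by (auto intro: meet_plus_le)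
    then show "u \<oplus> v \<in> ?I" using u v MD(3,4) by auto
  next
    fix v u assume v: "v \<in> ?I" and u: "u \<in> carrier A" "u \<preceq> v"
    have "u \<sqinter> ?z \<preceq> v \<sqinter> ?z"
      using u v le_trans[OF meet_le1[of u ?z] u(2)] by (intro meet_greatest) (auto simp: meet_le2)
    then show "u \<in> ?I" using u v MD(4) by auto
  qed auto
  moreover have "M \<subseteq> ?I"
  proof
    fix u assume "u \<in> M"
    then show "u \<in> ?I" using MD(1) MD(4)[OF meet_le1[of u ?z]] by simp
  qed
  moreover have "?I \<noteq> carrier A"
  proof
    assume "?I = carrier A"
    then have "\<one> \<sqinter> ?z \<in> M" by (metis (no_types, lifting) mem_Collect_eq one_closed)
    then show False using z by (simp add: mv_meet_def times_comm[of \<one>])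
  qed
  ultimately have "?I = M" using M unfolding mv_maximal_ideal_def by metis
  moreover have "?w \<in> ?I" using meet0[of ?w] MD(2) by simp
  ultimately show ?thesis by simp
qed simp

end

text \<open>By the Archimedean property a nonzero distance would have unbounded multiples. Slopes
  are known only through integer parts of multiples, that is, up to a bounded error; this removes
  the error.\<close>

lemma real_eq_of_bounded_multiples:
  fixes x y c :: real
  assumes "\<And>n::nat. n \<ge> 1 \<Longrightarrow> \<bar>real n * x - real n * y\<bar> \<le> c"
  shows "x = y"
proof (rule ccontr)
  assume "x \<noteq> y"
  then obtain n :: nat where n: "c < real n * \<bar>x - y\<bar>"
    using reals_Archimedean3[of "\<bar>x - y\<bar>"] by auto
  have "c \<ge> 0" using assms[of 1] by simp
  then have "n \<ge> 1" using n by (cases n) auto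
  then show False using assms[of n] n by (simp add: abs_mult flip: right_diff_distrib)
qed

section \<open>Chang's group of a chain and Hoelder's homomorphism to the reals\<close>

locale mv_chain = mv_algebra +
  assumes total: "\<lbrakk>x \<in> carrier A; y \<in> carrier A\<rbrakk> \<Longrightarrow> x \<preceq> y \<or> y \<preceq> x"
    and nontrivial: "\<zero> \<noteq> \<one>"
begin

text \<open>The pair \<open>(k, r)\<close> stands for the sum of \<open>k\<close> copies of \<open>\<one>\<close> and of \<open>r\<close> in the positive cone of
  Chang's totally ordered group of the chain.\<close>

definition carry_add :: "nat \<times> 'a \<Rightarrow> nat \<times> 'a \<Rightarrow> nat \<times> 'a" (infixl "\<boxplus>" 65) where
  "p \<boxplus> q = (if snd p \<oplus> snd q = \<one> then (fst p + fst q + 1, snd p \<odot> snd q)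
             else (fst p + fst q, snd p \<oplus> snd q))"

text \<open>The fractional part \<open>\<one>\<close> is excluded to give each group element one
  name: \<open>(k, \<one>)\<close> would be \<open>(k + 1, \<zero>)\<close>.\<close>

definition cone :: "(nat \<times> 'a) set" where
  "cone = UNIV \<times> (carrier A - {\<one>})"

lemma one_le_iff: "x \<in> carrier A \<Longrightarrow> \<one> \<preceq> x \<longleftrightarrow> x = \<one>"
  using le_antisym[of x \<one>] by auto

lemma carry_add_closed: "p \<in> cone \<Longrightarrow> q \<in> cone \<Longrightarrow> p \<boxplus> q \<in> cone"
  using times_le by (auto simp: cone_def carry_add_def) (metis one_le_iff times_le)

lemma carry_add_comm: "p \<in> cone \<Longrightarrow> q \<in> cone \<Longrightarrow> p \<boxplus> q = q \<boxplus> p"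
  by (auto simp: cone_def carry_add_def plus_comm times_comm)

lemma carry_add_zero: "p \<in> cone \<Longrightarrow> (0, \<zero>) \<boxplus> p = p"
  by (auto simp: cone_def carry_add_def)

text \<open>Totality of the order enters here: either \<open>x \<preceq> \<sim> y\<close>, or
  \<open>\<sim> y \<preceq> x\<close> and the sum is \<open>\<one>\<close>. So without a carry
  \<oplus> is the addition of the group.\<close>

lemma disjoint_of_plus_neq_one:
  "\<lbrakk>x \<oplus> y \<noteq> \<one>; x \<in> carrier A; y \<in> carrier A\<rbrakk> \<Longrightarrow> x \<odot> y = \<zero>"
  using total[of x "\<sim> y"] plus_eq_one_iff[of y x]
  by (auto simp: times_eq_zero_iff plus_comm)

text \<open>Both sides equal \<open>(r \<oplus> s) \<odot> (s \<oplus> t) \<odot> \<sim> s\<close>.\<close>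

lemma times_plus_swap:
  assumes "r \<odot> s = \<zero>" "s \<odot> t = \<zero>"
    and [simp]: "r \<in> carrier A" "s \<in> carrier A" "t \<in> carrier A"
  shows "(r \<oplus> s) \<odot> t = r \<odot> (s \<oplus> t)"
proof -
  have r: "(r \<oplus> s) \<odot> \<sim> s = r" and t: "(t \<oplus> s) \<odot> \<sim> s = t"
    using assms times_comm[of s t] by (simp_all add: diff_eq flip: times_eq_zero_iff)
  have "(r \<oplus> s) \<odot> t = (r \<oplus> s) \<odot> ((t \<oplus> s) \<odot> \<sim> s)" by (simp add: t)
  also have "\<dots> = ((r \<oplus> s) \<odot> \<sim> s) \<odot> (t \<oplus> s)" by (simp add: times_ac)
  finally show ?thesis by (simp add: r plus_comm)
qed

text \<open>The dual of \<open>times_plus_swap\<close>: negation exchanges \<oplus> with \<odot> and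
  \<open>\<one>\<close> with \<open>\<zero>\<close>.\<close>

lemma plus_times_swap:
  assumes "r \<oplus> s = \<one>" "s \<oplus> t = \<one>"
    and [simp]: "r \<in> carrier A" "s \<in> carrier A" "t \<in> carrier A"
  shows "(r \<odot> s) \<oplus> t = r \<oplus> (s \<odot> t)"
proof -
  have "\<sim> r \<odot> \<sim> s = \<zero>" "\<sim> s \<odot> \<sim> t = \<zero>"
    using assms by (simp_all flip: neg_plus)
  then have "\<sim> (\<sim> ((r \<odot> s) \<oplus> t)) = \<sim> (\<sim> (r \<oplus> (s \<odot> t)))"
    using times_plus_swap[of "\<sim> r" "\<sim> s" "\<sim> t"] by (simp add: neg_plus neg_times)
  then show ?thesis by simp
qed

text \<open>In the group both sides are \<open>r + s + t - 1\<close>. As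
  \<open>t \<preceq> \<sim> s\<close> and \<open>(r \<odot> s) \<oplus> \<sim> s = r\<close>, the
  left side lies below \<open>r\<close>; adding \<open>\<sim> r\<close> and subtracting it again
  therefore changes nothing, and produces the right side.\<close>

lemma plus_times_assoc:
  assumes "r \<oplus> s = \<one>" "s \<odot> t = \<zero>"
    and [simp]: "r \<in> carrier A" "s \<in> carrier A" "t \<in> carrier A"
  shows "(r \<odot> s) \<oplus> t = r \<odot> (s \<oplus> t)"
proof -
  have sr: "\<sim> r \<preceq> s" and ts: "t \<preceq> \<sim> s"
    using assms times_comm[of s t] by (simp_all flip: plus_eq_one_iff times_eq_zero_iff add: plus_comm)
  have "(r \<odot> s) \<oplus> t \<preceq> (r \<odot> s) \<oplus> \<sim> s"
    using ts by (intro plus_mono) auto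
  also have "(r \<odot> s) \<oplus> \<sim> s = r"
  proof -
    have "\<sim> s \<preceq> r" using sr neg_le_iff[of s "\<sim> r"] by simp
    then show ?thesis using le_split[of "\<sim> s" r] by simp
  qed
  finally have "(r \<odot> s) \<oplus> t \<preceq> r" by simp
  then have "(r \<odot> s) \<oplus> t = (((r \<odot> s) \<oplus> t) \<oplus> \<sim> r) \<odot> r"
    using diff_eq[of "(r \<odot> s) \<oplus> t" "\<sim> r"] by simp
  also have "((r \<odot> s) \<oplus> t) \<oplus> \<sim> r = (s \<odot> \<sim> (\<sim> r) \<oplus> \<sim> r) \<oplus> t"
    by (simp add: plus_ac times_comm)
  also have "\<dots> = s \<oplus> t" using le_split[of "\<sim> r" s] sr by simp
  finally show ?thesis by (simp add: times_comm)
qed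

text \<open>Split by whether \<open>r \<oplus> s\<close> and \<open>s \<oplus> t\<close> carry. In
  each case one exchange law shows that both bracketings test the same element for the second carry
  or leave the same fractional part.\<close>

lemma carry_add_assoc:
  assumes "p \<in> cone" "q \<in> cone" "u \<in> cone"
  shows "(p \<boxplus> q) \<boxplus> u = p \<boxplus> (q \<boxplus> u)"
proof -
  obtain i r j s k t where eq: "p = (i, r)" "q = (j, s)" "u = (k, t)"
    by (cases p, cases q, cases u)
  have [simp]: "r \<in> carrier A" "s \<in> carrier A" "t \<in> carrier A"
    and n1: "r \<noteq> \<one>" "s \<noteq> \<one>" "t \<noteq> \<one>"
    using assms by (auto simp: eq cone_def)
  have mixed: "((i, r) \<boxplus> (j, s)) \<boxplus> (k, t) = (i, r) \<boxplus> ((j, s) \<boxplus> (k, t))"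
    if rs: "r \<oplus> s = \<one>" and st: "s \<oplus> t \<noteq> \<one>"
      and [simp]: "r \<in> carrier A" "s \<in> carrier A" "t \<in> carrier A" for i r j s k t
  proof -
    have "(r \<odot> s) \<oplus> t \<preceq> s \<oplus> t" by (intro plus_mono) auto
    then have "(r \<odot> s) \<oplus> t \<noteq> \<one>" using st by (auto simp: one_le_iff)
    moreover have "r \<oplus> (s \<oplus> t) = \<one>" using rs by (simp flip: plus_assoc)
    moreover have "(r \<odot> s) \<oplus> t = r \<odot> (s \<oplus> t)"
      using rs disjoint_of_plus_neq_one[OF st] by (intro plus_times_assoc) auto
    ultimately show ?thesis using rs st by (simp add: carry_add_def)
  qed
  show ?thesis
  proof (cases "r \<oplus> s = \<one>"; cases "s \<oplus> t = \<one>")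
    assume 1: "r \<oplus> s = \<one>" "s \<oplus> t = \<one>"
    then have "(r \<odot> s) \<oplus> t = r \<oplus> (s \<odot> t)" by (intro plus_times_swap) auto
    then show ?thesis using 1 by (auto simp: eq carry_add_def times_assoc)
  next
    assume "r \<oplus> s = \<one>" "s \<oplus> t \<noteq> \<one>"
    then show ?thesis by (simp add: eq mixed)
  next
    assume 1: "r \<oplus> s \<noteq> \<one>" "s \<oplus> t = \<one>"
    \<comment> \<open>Reversing the order of the summands swaps the two mixed cases.\<close>
    have "(u \<boxplus> q) \<boxplus> p = u \<boxplus> (q \<boxplus> p)"
      unfolding eq using 1 by (intro mixed) (auto simp: plus_comm)
    then show ?thesis using assms by (metis carry_add_closed carry_add_comm)
  next
    assume 1: "r \<oplus> s \<noteq> \<one>" "s \<oplus> t \<noteq> \<one>"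
    then have "(r \<oplus> s) \<odot> t = r \<odot> (s \<oplus> t)"
      by (intro times_plus_swap disjoint_of_plus_neq_one) auto
    then show ?thesis using 1 by (auto simp: eq carry_add_def plus_assoc)
  qed
qed

primrec carry_mult :: "nat \<Rightarrow> nat \<times> 'a \<Rightarrow> nat \<times> 'a" where
  "carry_mult 0 p = (0, \<zero>)"
| "carry_mult (Suc n) p = p \<boxplus> carry_mult n p"

lemma carry_mult_closed: "p \<in> cone \<Longrightarrow> carry_mult n p \<in> cone"
  using nontrivial by (induction n) (auto simp: carry_add_closed, simp add: cone_def)

lemma carry_mult_add:
  "p \<in> cone \<Longrightarrow> carry_mult (m + n) p = carry_mult m p \<boxplus> carry_mult n p"
  by (induction m) (simp_all add: carry_add_zero carry_mult_closed carry_add_assoc)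

lemma carry_mult_carry_add:
  assumes p: "p \<in> cone" and q: "q \<in> cone"
  shows "carry_mult n (p \<boxplus> q) = carry_mult n p \<boxplus> carry_mult n q"
proof (induction n)
  case 0
  then show ?case using carry_add_zero[of "(0, \<zero>)"] nontrivial by (simp add: cone_def)
next
  case (Suc n)
  let ?P = "carry_mult n p" and ?Q = "carry_mult n q"
  have c: "?P \<in> cone" "?Q \<in> cone" using p q by (auto simp: carry_mult_closed)
  have "q \<boxplus> (?P \<boxplus> ?Q) = ?P \<boxplus> (q \<boxplus> ?Q)"
    using c q by (metis carry_add_assoc carry_add_comm)
  then show ?case using Suc p q c by (simp add: carry_add_assoc carry_add_closed)
qed

abbreviation "floor_mult n p \<equiv> fst (carry_mult n p)"

lemma fst_carry_add: "fst p + fst q \<le> fst (p \<boxplus> q)" "fst (p \<boxplus> q) \<le> fst p + fst q + 1"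
  by (auto simp: carry_add_def)

text \<open>Each of the \<open>m\<close> additions of \<open>carry_mult n p\<close> contributes its
  integer part and at most one carry.\<close>

lemma floor_mult_bounds:
  assumes "p \<in> cone"
  shows "m * floor_mult n p \<le> floor_mult (m * n) p \<and> floor_mult (m * n) p \<le> m * (floor_mult n p + 1)"
proof (induction m)
  case (Suc m)
  then show ?case
    using fst_carry_add[of "carry_mult n p" "carry_mult (m * n) p"] carry_mult_add[OF assms, of n "m * n"]
    by auto
qed simp

text \<open>Hoelder's real number of \<open>p\<close>, measured by the unit
  \<open>(1, \<zero>)\<close>: how many units fit into \<open>n\<close> copies of \<open>p\<close>,
  per copy. Infinitesimals get slope 0, so the map need not be injective.\<close>

definition slope :: "nat \<times> 'a \<Rightarrow> real" where
  "slope p = (SUP n\<in>{1..}. real (floor_mult n p) / real n)"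

text \<open>Integer parts for two multipliers are compared through their product: \<open>n *
  floor_mult m p \<le> floor_mult (m * n) p \<le> m * (floor_mult n p + 1)\<close>. So every
  \<open>floor_mult m p / m\<close> is below every \<open>(floor_mult n p + 1) / n\<close>, and the
  supremum lies in between.\<close>

lemma floor_mult_slope:
  assumes p: "p \<in> cone" and n: "n \<ge> 1"
  shows "floor_mult n p \<le> real n * slope p" "real n * slope p \<le> floor_mult n p + 1"
proof -
  have le: "real (floor_mult m p) / real m \<le> (real (floor_mult n p) + 1) / real n"
    if "m \<ge> 1" "n \<ge> 1" for m n
  proof -
    have "n * floor_mult m p \<le> m * (floor_mult n p + 1)"
      using floor_mult_bounds[OF p, of n m] floor_mult_bounds[OF p, of m n]
      by (metis order.trans mult.commute)
    then have "real (n * floor_mult m p) \<le> real (m * (floor_mult n p + 1))"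
      by (simp only: of_nat_le_iff)
    then show ?thesis using that by (simp add: field_simps)
  qed
  have "real (floor_mult n p) / real n \<le> slope p"
    unfolding slope_def using n le[OF _ n] by (intro cSUP_upper bdd_aboveI2) auto
  then show "floor_mult n p \<le> real n * slope p" using n by (simp add: field_simps)
  have "slope p \<le> (real (floor_mult n p) + 1) / real n"
    unfolding slope_def using n le[OF _ n] by (intro cSUP_least) auto
  then show "real n * slope p \<le> floor_mult n p + 1" using n by (simp add: field_simps)
qed

lemma slope_add:
  assumes p: "p \<in> cone" and q: "q \<in> cone"
  shows "slope (p \<boxplus> q) = slope p + slope q"
proof (rule real_eq_of_bounded_multiples)
  fix n :: nat assume n: "n \<ge> 1"
  have "floor_mult n p + floor_mult n q \<le> floor_mult n (p \<boxplus> q)"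
    "floor_mult n (p \<boxplus> q) \<le> floor_mult n p + floor_mult n q + 1"
    unfolding carry_mult_carry_add[OF p q] by (rule fst_carry_add)+
  then have "real (floor_mult n p) + real (floor_mult n q) \<le> real (floor_mult n (p \<boxplus> q))"
    "real (floor_mult n (p \<boxplus> q)) \<le> real (floor_mult n p) + real (floor_mult n q) + 1"
    by linarith+
  \<comment> \<open>Both quantities lie in the interval of length 2 that starts at
    \<open>floor_mult n p + floor_mult n q\<close>.\<close>
  then show "\<bar>real n * slope (p \<boxplus> q) - real n * (slope p + slope q)\<bar> \<le> 2"
    using floor_mult_slope[OF p n] floor_mult_slope[OF q n]
      floor_mult_slope[OF carry_add_closed[OF p q] n]
    by (simp add: distrib_left abs_le_iff)
qed

lemma slope_integer: "slope (k, \<zero>) = real k"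
proof (rule real_eq_of_bounded_multiples)
  fix n :: nat assume n: "n \<ge> 1"
  have "carry_mult n (k, \<zero>) = (n * k, \<zero>)" for n
    using nontrivial by (induction n) (auto simp: carry_add_def)
  then show "\<bar>real n * slope (k, \<zero>) - real n * real k\<bar> \<le> 1"
    using floor_mult_slope[of "(k, \<zero>)", OF _ n] nontrivial by (simp add: cone_def)
qed

text \<open>The case \<open>n = 1\<close> of \<open>floor_mult_slope\<close>, where the integer part
  is 0.\<close>

lemma slope_fraction:
  assumes "r \<in> carrier A" "r \<noteq> \<one>"
  shows "0 \<le> slope (0, r)" "slope (0, r) \<le> 1"
  using floor_mult_slope[of "(0, r)" 1] assms by (auto simp: cone_def carry_add_def)

theorem chain_hom_exists: "\<exists>h. h \<in> mv_hom A unit_mv"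
proof
  \<comment> \<open>As \<open>\<one>\<close> is not a fractional part, its value is set
    separately.\<close>
  define h where "h a = (if a = \<one> then 1 else slope (0, a))" for a
  have cone: "(k, a) \<in> cone" if "a \<in> carrier A" "a \<noteq> \<one>" for k a
    using that by (simp add: cone_def)
  \<comment> \<open>The sum of \<open>a\<close> and \<open>b\<close>, and that of the unit and
    \<open>a \<odot> b\<close>, are the same group element \<open>(1, a \<odot> b)\<close>;
    additivity of \<open>slope\<close> is applied to each.\<close>
  have carry: "slope (0, a) + slope (0, b) = 1 + slope (0, a \<odot> b)"
    if "a \<oplus> b = \<one>" "a \<noteq> \<one>" "b \<noteq> \<one>" "a \<in> carrier A" "b \<in> carrier A" for a b
  proof -
    have ab: "(0, a) \<boxplus> (0, b) = (1, a \<odot> b)" using that by (simp add: carry_add_def)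
    then have "(1, a \<odot> b) \<in> cone" using carry_add_closed cone that by metis
    then have c: "(0, a \<odot> b) \<in> cone" by (simp add: cone_def)
    have "(1, \<zero>) \<boxplus> (0, a \<odot> b) = (1, a \<odot> b)"
      using c that by (simp add: carry_add_def cone_def)
    then show ?thesis
      using slope_add[of "(0, a)" "(0, b)"] slope_add[of "(1, \<zero>)" "(0, a \<odot> b)"] c that cone
        nontrivial by (simp add: ab slope_integer)
  qed
  have range: "0 \<le> h a \<and> h a \<le> 1" if "a \<in> carrier A" for a
    using that slope_fraction by (simp add: h_def)
  have plus: "h (a \<oplus> b) = min (h a + h b) 1" if "a \<in> carrier A" "b \<in> carrier A" for a b
  proof (cases "a = \<one> \<or> b = \<one>")
    case True
    then show ?thesis using that range[of a] range[of b] by (auto simp: h_def)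
  next
    case False
    show ?thesis
    proof (cases "a \<oplus> b = \<one>")
      case True
      then have "a \<odot> b \<noteq> \<one>"
        using False that times_le[of a b] one_le_iff[of a] by metis
      then show ?thesis using False True that carry[of a b] slope_fraction(1)[of "a \<odot> b"]
        by (simp add: h_def)
    next
      case nc: False
      then have "(0, a) \<boxplus> (0, b) = (0, a \<oplus> b)" by (simp add: carry_add_def)
      then show ?thesis
        using False nc that slope_add[of "(0, a)" "(0, b)"] cone slope_fraction(2)[of "a \<oplus> b"]
        by (simp add: h_def)
    qed
  qed
  have neg: "h (\<sim> a) = 1 - h a" if "a \<in> carrier A" for a
  proof -
    have "\<sim> a = \<one> \<longleftrightarrow> a = \<zero>" using that by (metis neg_neg neg_one neg_zero)
    then show ?thesis
      using that carry[of a "\<sim> a"] nontrivial by (auto simp: h_def slope_integer)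
  qed
  show "h \<in> mv_hom A unit_mv"
    using range plus neg nontrivial by (simp add: mv_hom_def h_def slope_integer)
qed

end

section \<open>Maximal ideals as kernels of homomorphisms to [0,1]\<close>

context mv_algebra
begin

lemma hom_kernel_ideal:
  assumes h: "h \<in> mv_hom A unit_mv"
  shows "mv_ideal A {x \<in> carrier A. h x = 0}" "{x \<in> carrier A. h x = 0} \<noteq> carrier A"
proof -
  note hh = mv_homD[OF h] mv_hom_derived[OF mv_algebra_axioms h]
  have "h x \<le> h y" if "x \<preceq> y" "x \<in> carrier A" "y \<in> carrier A" for x y
  proof -
    have "h (\<sim> x \<oplus> y) = 1" using that hh by (simp add: mv_le_def)
    then show ?thesis using that hh by (simp add: min_def split: if_splits)
  qed
  then show "mv_ideal A {x \<in> carrier A. h x = 0}"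
    using hh unfolding mv_ideal_def by (fastforce intro: antisym)
  have "\<one> \<notin> {x \<in> carrier A. h x = 0}"
    using hh(5) by simp
  then show "{x \<in> carrier A. h x = 0} \<noteq> carrier A"
    using one_closed by blast
qed

text \<open>The quotient by \<open>M\<close> is a nontrivial chain, hence has a homomorphism to
  [0,1]. Nothing so far says that this map is injective; maximality closes the gap, since the kernel
  of the composite is a proper ideal above \<open>M\<close>.\<close>

theorem maximal_ideal_hom_kernel:
  assumes M: "mv_maximal_ideal A M"
  obtains h where "h \<in> mv_hom A unit_mv" "M = {x \<in> carrier A. h x = 0}"
proof -
  have I: "mv_ideal A M" and ne: "M \<noteq> carrier A"
    using M by (simp_all add: mv_maximal_ideal_def)
  interpret mv_congruence A "mv_ideal_rel A M" by (rule mv_congruence_ideal[OF I])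
  interpret Q: mv_algebra Q by (rule mv_algebra_quotient)
  note cc = mv_homD[OF cls_hom] mv_hom_derived[OF mv_algebra_axioms cls_hom]
  have zero_iff: "cls x = cls \<zero> \<longleftrightarrow> x \<in> M" if "x \<in> carrier A" for x
    using that mv_idealD[OF I] by (simp add: cls_eq_iff mv_ideal_rel_iff[OF I])
  have le_iff: "mv_le Q (cls x) (cls y) \<longleftrightarrow> x \<odot> \<sim> y \<in> M" if "x \<in> carrier A" "y \<in> carrier A" for x y
    using that by (simp add: Q.le_iff_times cls_closed zero_iff cc flip: cc(2-6))
  interpret Q: mv_chain Q
  proof
    fix X Y assume "X \<in> carrier Q" "Y \<in> carrier Q"
    then obtain x y where "x \<in> carrier A" "X = cls x" "y \<in> carrier A" "Y = cls y" by (elim cls_E)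
    then show "mv_le Q X Y \<or> mv_le Q Y X" using maximal_ideal_prime[OF M] by (simp add: le_iff)
  next
    have "\<one> \<notin> M" using ne mv_idealD[OF I] le_one by blast
    then have "cls \<one> \<noteq> cls \<zero>" by (simp add: zero_iff)
    then show "\<zero>\<^bsub>Q\<^esub> \<noteq> \<one>\<^bsub>Q\<^esub>" by (simp add: cc(4,5)[symmetric])
  qed
  obtain g where g: "g \<in> mv_hom Q unit_mv" using Q.chain_hom_exists by blast
  let ?h = "g \<circ> cls"
  have h: "?h \<in> mv_hom A unit_mv" by (rule mv_hom_compose[OF cls_hom g])
  have "M \<subseteq> {x \<in> carrier A. ?h x = 0}"
    using mv_idealD(1)[OF I] zero_iff[THEN iffD2] mv_homD(4)[OF g] by (auto simp: cls_zero)
  then have "M = {x \<in> carrier A. ?h x = 0}"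
    using M hom_kernel_ideal[OF h] unfolding mv_maximal_ideal_def by metis
  with h that show thesis by blast
qed

text \<open>The maps \<open>x \<mapsto> x \<oplus> x\<close> and \<open>x \<mapsto> x \<odot> x\<close> double distances on \<open>[0,1/2]\<close> and on \<open>[1/2,1]\<close>.
  Iterating them drives two distinct values apart until one of them is 0 and the other is not.\<close>

lemma hom_separation:
  assumes f: "f \<in> mv_hom A unit_mv" and g: "g \<in> mv_hom A unit_mv"
    and "a \<in> carrier A" "f a < g a"
  shows "\<exists>b\<in>carrier A. f b = 0 \<and> 0 < g b"
proof -
  note ff = mv_homD[OF f] mv_hom_derived[OF mv_algebra_axioms f]
  note gg = mv_homD[OF g] mv_hom_derived[OF mv_algebra_axioms g]
  obtain n where "1 / 2 ^ n < g a - f a"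
    using assms(4) real_arch_pow_inv[of "g a - f a" "1/2"] by (auto simp: power_one_over)
  with assms(3) show ?thesis
  proof (induction n arbitrary: a)
    \<comment> \<open>A gap larger than 1 cannot occur in [0,1].\<close>
    case 0
    then show ?case using ff(1)[of a] gg(1)[of a] by auto
  next
    case (Suc n)
    have fa: "0 \<le> f a" "f a \<le> 1" and ga: "0 \<le> g a" "g a \<le> 1"
      using Suc.prems ff(1)[of a] gg(1)[of a] by auto
    have d: "1 / 2 ^ n < 2 * g a - 2 * f a" using Suc.prems(2) by (simp add: field_simps)
    moreover have "0 < 1 / (2 ^ n :: real)" by simp
    ultimately have lt: "f a < g a" by linarith
    consider "g a \<le> 1/2" | "1/2 \<le> f a" | "f a < 1/2" "1/2 < g a" by linarith
    then show ?case
    proof cases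
      case 1
      moreover have "f a \<le> 1/2" using 1 lt by simp
      ultimately show ?thesis
        using Suc.IH[of "a \<oplus> a"] Suc.prems(1) d ff gg by simp
    next
      case 2
      moreover have "1/2 \<le> g a" using 2 lt by simp
      ultimately show ?thesis
        using Suc.IH[of "a \<odot> a"] Suc.prems(1) d ff gg by simp
    next
      \<comment> \<open>\<open>a \<odot> a\<close> sends values below 1/2 to 0 and values above 1/2
        to positive ones.\<close>
      case 3
      then show ?thesis
        using Suc.prems(1) ff gg by (intro bexI[of _ "a \<odot> a"]) auto
    qed
  qed
qed

text \<open>Separation rules out \<open>f b < g b\<close> for every \<open>b\<close>; the opposite
  inequality is the same fact at \<open>\<sim> a\<close>. Hence one inclusion of kernels is
  enough.\<close>

theorem hom_eq_of_kernel_subset: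
  assumes f: "f \<in> mv_hom A unit_mv" and g: "g \<in> mv_hom A unit_mv"
    and ker: "\<And>b. \<lbrakk>b \<in> carrier A; f b = 0\<rbrakk> \<Longrightarrow> g b = 0"
    and a: "a \<in> carrier A"
  shows "f a = g a"
proof -
  have "\<not> f b < g b" if "b \<in> carrier A" for b
    using hom_separation[OF f g that] ker by force
  from this[OF a] this[of "\<sim> a"] show ?thesis
    using a mv_homD(3)[OF f a] mv_homD(3)[OF g a] by simp
qed

text \<open>If a larger ideal contains \<open>x\<close> with \<open>h x > 0\<close>, repeated
  doubling of \<open>x\<close> gives a member \<open>y\<close> with \<open>h y = 1\<close>; then
  \<open>\<sim> y\<close> is in the kernel, so the ideal contains
  \<open>y \<oplus> \<sim> y = \<one>\<close>.\<close>

lemma hom_kernel_maximal: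
  assumes h: "h \<in> mv_hom A unit_mv"
  shows "mv_maximal_ideal A {x \<in> carrier A. h x = 0}"
  unfolding mv_maximal_ideal_def
proof (intro conjI allI impI hom_kernel_ideal[OF h])
  note hh = mv_homD[OF h] mv_hom_derived[OF mv_algebra_axioms h]
  fix I assume I: "mv_ideal A I \<and> {x \<in> carrier A. h x = 0} \<subseteq> I"
  then have "mv_ideal A I" by simp
  note ID = mv_idealD[OF this]
  show "I = {x \<in> carrier A. h x = 0} \<or> I = carrier A"
  proof (rule disjCI)
    assume "I \<noteq> carrier A"
    then have one: "\<one> \<notin> I" using ID le_one by blast
    have "h x = 0" if x: "x \<in> I" for x
    proof (rule ccontr)
      assume "h x \<noteq> 0"
      then have pos: "0 < h x" using hh(1)[OF ID(1)[OF x]] by simp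
      have "\<exists>y\<in>I. h y = min 1 (2 ^ n * h x)" for n :: nat
      proof (induction n)
        case 0
        then show ?case using x hh(1)[OF ID(1)[OF x]] by auto
      next
        case (Suc n)
        then obtain y where y: "y \<in> I" "h y = min 1 (2 ^ n * h x)" by blast
        have "h (y \<oplus> y) = min 1 (2 ^ Suc n * h x)"
          using hh(2)[OF ID(1) ID(1), OF y(1) y(1)] y(2) by (simp add: min_def)
        then show ?case using ID(3)[OF y(1) y(1)] by blast
      qed
      moreover obtain n :: nat where "1 / h x < 2 ^ n"
        using real_arch_pow[of 2 "1 / h x"] by auto
      moreover from this have "1 \<le> 2 ^ n * h x" using pos by (simp add: field_simps)
      ultimately obtain y where y: "y \<in> I" "h y = 1" by (metis min_absorb1)
      then have "\<sim> y \<in> I" using I ID(1) hh(3) by auto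
      then have "y \<oplus> \<sim> y \<in> I" using ID(3) y by blast
      then show False using one y ID(1) by simp
    qed
    then show "I = {x \<in> carrier A. h x = 0}" using I ID(1) by blast
  qed
qed

end

section \<open>Representations\<close>

text \<open>The maximal spectrum, with points given as homomorphisms. The product space has only
  extensional functions, so values off the carrier do not create extra points.\<close>

definition hom_space :: "('a, 'm) mv_scheme \<Rightarrow> ('a \<Rightarrow> real) topology" where
  "hom_space A = subtopology (product_topology (\<lambda>_. top_of_set {0..1}) (carrier A)) (mv_hom A unit_mv)"

lemma topspace_hom_space:
  "topspace (hom_space A) = extensional (carrier A) \<inter> mv_hom A unit_mv"
  by (auto simp: hom_space_def mv_hom_def PiE_def)

lemma continuous_map_hom_space:
  assumes "a \<in> carrier A"
  shows "continuous_map (product_topology (\<lambda>_. top_of_set {0..1::real}) (carrier A)) euclideanreal (\<lambda>h. h a)"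
  using continuous_map_product_projection[OF assms, of "\<lambda>_. top_of_set {0..1::real}"]
  by (simp add: continuous_map_in_subtopology)

text \<open>The homomorphisms are cut out of Tychonoff's cube by equations between finitely many
  coordinates, and each of these is a closed condition.\<close>

lemma compact_hom_space:
  fixes A :: "('a, 'm) mv_scheme" (structure)
  assumes "mv_algebra A"
  shows "compact_space (hom_space A)"
proof -
  interpret mv_algebra A by fact
  let ?P = "product_topology (\<lambda>_. top_of_set {0..1::real}) (carrier A)"
  let ?E = "\<lambda>f g :: ('a \<Rightarrow> real) \<Rightarrow> real. {h \<in> topspace ?P. f h = g h}"
  have cl: "closedin ?P (?E f g)"
    if "continuous_map ?P euclideanreal f" "continuous_map ?P euclideanreal g" for f g
    using that by (intro closedin_continuous_maps_eq) auto
  note [continuous_intros] = continuous_map_hom_space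
  have eq: "topspace ?P \<inter> mv_hom A unit_mv =
      topspace ?P \<inter> (\<Inter>x\<in>carrier A. \<Inter>y\<in>carrier A. ?E (\<lambda>h. h (x \<oplus> y)) (\<lambda>h. min (h x + h y) 1))
      \<inter> (\<Inter>x\<in>carrier A. ?E (\<lambda>h. h (\<sim> x)) (\<lambda>h. 1 - h x)) \<inter> ?E (\<lambda>h. h \<zero>) (\<lambda>h. 0)"
    using zero_closed by (auto simp: mv_hom_def PiE_iff)
  have "carrier A \<noteq> {}" using zero_closed by blast
  then have "closedin ?P (topspace ?P \<inter> mv_hom A unit_mv)"
    unfolding eq
    by (intro closedin_Int closedin_INT closedin_topspace cl continuous_intros) (auto simp: closed)
  moreover have "compact_space ?P"
    by (simp add: compact_space_product_topology compact_space_subtopology)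
  ultimately have "compact_space (subtopology ?P (topspace ?P \<inter> mv_hom A unit_mv))"
    by (intro compact_space_subtopology closedin_compact_space)
  then show ?thesis unfolding hom_space_def subtopology_restrict[of ?P "mv_hom A unit_mv"] .
qed

lemma Hausdorff_hom_space: "Hausdorff_space (hom_space A)"
  unfolding hom_space_def
  by (intro Hausdorff_space_subtopology) (simp add: Hausdorff_space_product_topology Hausdorff_space_subtopology)

text \<open>Evaluation on the spectrum is injective: the distance of two elements with the same
  image lies in every maximal ideal, hence in the radical, which is trivial.\<close>

theorem mv_representation_exists:
  fixes A :: "('a, 'm) mv_scheme" (structure)
  assumes A: "mv_algebra A" and ss: "mv_semisimple A"
  shows "\<exists>(X :: ('a \<Rightarrow> real) topology) e. mv_representation A X e"
proof -
  interpret mv_algebra A by fact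
  let ?X = "hom_space A"
  define e where "e a = (\<lambda>h\<in>topspace ?X. h a)" for a
  have hom: "h \<in> mv_hom A unit_mv" if "h \<in> topspace ?X" for h
    using that by (simp add: topspace_hom_space)
  have "e a \<in> carrier (cont_mv ?X)" if "a \<in> carrier A" for a
    unfolding e_def
  proof (rule restrict_mem_cont_mv)
    show "continuous_map ?X euclideanreal (\<lambda>h. h a)"
      unfolding hom_space_def using that
      by (intro continuous_map_from_subtopology continuous_map_hom_space)
    show "0 \<le> h a \<and> h a \<le> 1" if "h \<in> topspace ?X" for h
      using mv_homD(1)[OF hom[OF that] \<open>a \<in> carrier A\<close>] by simp
  qed
  then have "e \<in> mv_hom A (cont_mv ?X)"
    unfolding mv_hom_def[of A "cont_mv ?X"]
    by (auto simp: e_def fun_eq_iff mv_homD(2-4)[OF hom])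
  moreover have "inj_on e (carrier A)"
  proof (rule inj_onI)
    fix a b assume a [simp]: "a \<in> carrier A" and b [simp]: "b \<in> carrier A" and ab: "e a = e b"
    let ?d = "(a \<odot> \<sim> b) \<oplus> (b \<odot> \<sim> a)"
    have "?d \<in> M" if M: "mv_maximal_ideal A M" for M
    proof -
      obtain h where h: "h \<in> mv_hom A unit_mv" "M = {x \<in> carrier A. h x = 0}"
        using maximal_ideal_hom_kernel[OF M] .
      \<comment> \<open>The values of \<open>h\<close> off the carrier are arbitrary; only its
        restriction is a point of the space.\<close>
      have "restrict h (carrier A) \<in> topspace ?X"
        using h(1) by (auto simp: topspace_hom_space mv_hom_def)
      then have "h a = h b"
        using fun_cong[OF ab, of "restrict h (carrier A)"] by (simp add: e_def)
      moreover have "h b \<in> {0..1}" using mv_homD(1)[OF h(1) b] by simp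
      ultimately show ?thesis
        by (simp add: h(2) mv_homD[OF h(1)] mv_hom_derived[OF A h(1)])
    qed
    then have "?d \<in> mv_radical A" by (simp add: mv_radical_def)
    then have "?d = \<zero>" using ss by (simp add: mv_semisimple_def)
    then show "a = b" by (simp add: dist_eq_zero_iff)
  qed
  ultimately show ?thesis
    using compact_hom_space[OF A] Hausdorff_hom_space[of A] unfolding mv_representation_def by blast
qed

text \<open>Were \<open>f\<close> not an evaluation, its kernel would contain for every \<open>x\<close> an element positive at \<open>x\<close>.
  By compactness a finite sum of such elements is bounded away from \<open>0\<close>, so a multiple of it is
  \<open>\<one>\<close>, although it still lies in the kernel.\<close>

theorem hom_is_evaluation:
  fixes A :: "('a, 'm) mv_scheme" (structure)
  assumes A: "mv_algebra A" and rep: "mv_representation A X e" and f: "f \<in> mv_hom A unit_mv"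
  obtains x where "x \<in> topspace X" "\<And>a. a \<in> carrier A \<Longrightarrow> f a = e a x"
proof -
  interpret mv_algebra A by fact
  have X: "compact_space X" and e: "e \<in> mv_hom A (cont_mv X)" and inj: "inj_on e (carrier A)"
    using rep by (auto simp: mv_representation_def)
  have ev: "(\<lambda>a. e a x) \<in> mv_hom A unit_mv" if "x \<in> topspace X" for x
    using mv_hom_compose[OF e eval_cont_mv_hom[OF that]] by (simp add: o_def)
  let ?K = "{a \<in> carrier A. f a = 0}"
  have K: "mv_ideal A ?K" by (rule hom_kernel_ideal[OF f])
  have cont: "continuous_map X euclideanreal (e a)" if "a \<in> carrier A" for a
    using mv_homD(1)[OF e that] by (simp add: mem_cont_mv_iff)
  have "\<exists>x\<in>topspace X. \<forall>a\<in>?K. e a x = 0"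
  proof (rule ccontr)
    assume "\<not> ?thesis"
    then have ex: "\<exists>a\<in>?K. e a x \<noteq> 0" if "x \<in> topspace X" for x using that by blast
    \<comment> \<open>\<open>?U (a, n)\<close> consists of points at which \<open>n\<close>
      doublings of \<open>a\<close> reach 1.\<close>
    let ?U = "\<lambda>(a, n::nat). {x \<in> topspace X. e a x \<in> {1 / 2 ^ n <..}}"
    have "\<exists>F. finite F \<and> F \<subseteq> ?U ` (?K \<times> UNIV) \<and> topspace X \<subseteq> \<Union>F"
    proof (rule compactinD[of X])
      show "compactin X (topspace X)" using X by (simp add: compact_space_def)
      fix V assume "V \<in> ?U ` (?K \<times> UNIV)"
      then obtain a n where "a \<in> carrier A" "V = ?U (a, n)" by auto
      then show "openin X V"
        using openin_continuous_map_preimage[OF cont[of a], of "{1 / 2 ^ n <..}"] by simp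
    next
      show "topspace X \<subseteq> \<Union> (?U ` (?K \<times> UNIV))"
      proof
        fix x assume x: "x \<in> topspace X"
        then obtain a where a: "a \<in> ?K" "e a x \<noteq> 0" using ex by blast
        then have "0 < e a x" using mv_homD(1)[OF ev[OF x], of a] by auto
        then obtain n where "1 / 2 ^ n < e a x"
          using real_arch_pow_inv[of "e a x" "1/2"] by (auto simp: power_one_over)
        then show "x \<in> \<Union> (?U ` (?K \<times> UNIV))" using a x by auto
      qed
    qed
    then obtain F where F: "finite F" "F \<subseteq> ?U ` (?K \<times> UNIV)" "topspace X \<subseteq> \<Union>F" by blast
    have "\<exists>b\<in>?K. \<forall>x\<in>topspace X \<inter> \<Union>F. e b x = 1"
      using F(1,2)
    proof (induction F rule: finite_induct)
      case empty
      show ?case using mv_idealD(2)[OF K] by blast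
    next
      case (insert V F)
      then obtain b where b: "b \<in> ?K" "\<forall>x\<in>topspace X \<inter> \<Union>F. e b x = 1" by blast
      from insert.prems obtain a n where a: "a \<in> ?K" and V: "V = ?U (a, n)" by auto
      have "\<exists>c\<in>?K. \<forall>x\<in>topspace X. e c x = min 1 (2 ^ n * e a x)"
      proof (induction n)
        case 0
        then show ?case using a mv_homD(1)[OF ev] by (intro bexI[OF _ a]) force
      next
        case (Suc n)
        then obtain c where c: "c \<in> ?K" "\<forall>x\<in>topspace X. e c x = min 1 (2 ^ n * e a x)" by blast
        have "e (c \<oplus> c) x = min 1 (2 ^ Suc n * e a x)" if "x \<in> topspace X" for x
          using c that mv_homD(2)[OF ev[OF that], of c c] by (simp add: min_def)
        then show ?case using mv_idealD(3)[OF K c(1) c(1)] by blast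
      qed
      then obtain c where c: "c \<in> ?K" "\<forall>x\<in>topspace X. e c x = min 1 (2 ^ n * e a x)" by blast
      have "e (b \<oplus> c) x = 1" if x: "x \<in> topspace X \<inter> \<Union>(insert V F)" for x
      proof -
        have xX: "x \<in> topspace X" using x by blast
        have eq: "e (b \<oplus> c) x = min (e b x + e c x) 1"
          using mv_homD(2)[OF ev[OF xX], of b c] b c by simp
        have pos: "0 \<le> e b x" "0 \<le> e c x" "e c x \<le> 1"
          using mv_homD(1)[OF ev[OF xX]] b(1) c(1) by auto
        show ?thesis
        proof (cases "x \<in> V")
          case True
          then have "1 \<le> 2 ^ n * e a x" by (auto simp: V field_simps)
          then show ?thesis using c(2) xX eq pos by simp
        next
          case False
          then show ?thesis using x b(2) eq pos by auto
        qed
      qed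
      then show ?case using mv_idealD(3)[OF K b(1) c(1)] by blast
    qed
    then obtain b where b: "b \<in> ?K" "\<forall>x\<in>topspace X. e b x = 1" using F(3) by blast
    \<comment> \<open>Injectivity of the representation will turn the constant function 1 into
      \<open>b = \<one>\<close>, against \<open>f b = 0\<close>.\<close>
    have "e b = e \<one>"
    proof (rule extensionalityI)
      show "e b \<in> extensional (topspace X)" "e \<one> \<in> extensional (topspace X)"
        using mv_homD(1)[OF e] b(1) by (auto simp: mem_cont_mv_iff)
      show "e b x = e \<one> x" if "x \<in> topspace X" for x
        using b(2) that mv_hom_derived(1)[OF A ev[OF that]] by simp
    qed
    then have "b = \<one>" using inj b(1) by (auto dest: inj_onD)
    then show False using b(1) mv_hom_derived(1)[OF A f] by simp
  qed
  then obtain x where x: "x \<in> topspace X" "\<forall>a\<in>?K. e a x = 0" by blast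
  show thesis
    using hom_eq_of_kernel_subset[OF f ev[OF x(1)]] x(2) by (intro that[OF x(1)]) auto
qed

section \<open>The divisible hull\<close>

lemma divisible_hull_ops [simp]:
  "\<zero>\<^bsub>divisible_hull X S\<^esub> = \<zero>\<^bsub>cont_mv X\<^esub>" "\<one>\<^bsub>divisible_hull X S\<^esub> = \<one>\<^bsub>cont_mv X\<^esub>"
  "\<sim>\<^bsub>divisible_hull X S\<^esub> f = \<sim>\<^bsub>cont_mv X\<^esub> f"
  "f \<oplus>\<^bsub>divisible_hull X S\<^esub> g = f \<oplus>\<^bsub>cont_mv X\<^esub> g" "f \<odot>\<^bsub>divisible_hull X S\<^esub> g = f \<odot>\<^bsub>cont_mv X\<^esub> g"
  "f \<squnion>\<^bsub>divisible_hull X S\<^esub> g = f \<squnion>\<^bsub>cont_mv X\<^esub> g" "f \<sqinter>\<^bsub>divisible_hull X S\<^esub> g = f \<sqinter>\<^bsub>cont_mv X\<^esub> g"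
  by (simp_all add: divisible_hull_def mv_one_def mv_times_def mv_join_def mv_meet_def)

text \<open>The term for \<open>i\<close> is the length of the part of the interval [0,y] that lies
  in [i-1,i].\<close>

lemma sum_clamp:
  fixes y :: real
  assumes "0 \<le> y"
  shows "(\<Sum>i = 1..n. max 0 (min 1 (y - (real i - 1)))) = min y (real n)"
  using assms by (induction n) auto

lemma sum_list_concat_replicate:
  "sum_list (map f (concat (replicate m xs))) = real m * (sum_list (map f xs) :: real)"
  by (induction m) (simp_all add: algebra_simps)

lemma mem_divisible_hull_iff:
  "a \<in> carrier (divisible_hull X S) \<longleftrightarrow> a \<in> carrier (cont_mv X) \<and>
     (\<exists>n\<ge>1. \<exists>b :: nat \<Rightarrow> 'x \<Rightarrow> real. (\<forall>i\<in>{1..n}. b i \<in> S) \<and>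
       (\<forall>x\<in>topspace X. a x = (\<Sum>i=1..n. b i x / real n)))" for X :: "'x topology"
  by (simp add: divisible_hull_def)

locale cont_subalgebra =
  fixes X :: "'x topology" and S :: "('x \<Rightarrow> real) set"
  assumes subset: "S \<subseteq> carrier (cont_mv X)"
    and zero_mem: "\<zero>\<^bsub>cont_mv X\<^esub> \<in> S"
    and neg_mem: "f \<in> S \<Longrightarrow> \<sim>\<^bsub>cont_mv X\<^esub> f \<in> S"
    and plus_mem: "\<lbrakk>f \<in> S; g \<in> S\<rbrakk> \<Longrightarrow> f \<oplus>\<^bsub>cont_mv X\<^esub> g \<in> S"
begin

lemma range: "\<lbrakk>f \<in> S; x \<in> topspace X\<rbrakk> \<Longrightarrow> 0 \<le> f x \<and> f x \<le> 1"
  using subset by (auto simp: mem_cont_mv_iff)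

lemma times_mem: "\<lbrakk>f \<in> S; g \<in> S\<rbrakk> \<Longrightarrow> f \<odot>\<^bsub>cont_mv X\<^esub> g \<in> S"
  unfolding mv_times_def by (intro neg_mem plus_mem)

text \<open>Writing \<open>\<tau>\<close> for truncation to \<open>[0,1]\<close>, one has
  \<open>\<tau> (c + s - j) = \<tau> (s - j) \<oplus> (\<tau> (s - (j - 1)) \<odot> c)\<close> whenever \<open>0 \<le> c \<le> 1\<close>.\<close>

lemma clamp_sum_mem:
  assumes "set bs \<subseteq> S"
  shows "(\<lambda>x\<in>topspace X. max 0 (min 1 (sum_list (map (\<lambda>b. b x) bs) - of_int j))) \<in> S"
  using assms
proof (induction bs arbitrary: j)
  case Nil
  have one: "(\<lambda>x\<in>topspace X. 1) \<in> S"
    using neg_mem[OF zero_mem] by (simp add: restrict_def cong: if_cong)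
  have "(\<lambda>x\<in>topspace X. max 0 (min 1 (- real_of_int j))) = (if j < 0 then (\<lambda>x\<in>topspace X. 1) else (\<lambda>x\<in>topspace X. 0))"
    by (auto simp: fun_eq_iff)
  then show ?case using one zero_mem by simp
next
  case (Cons c bs)
  let ?t = "\<lambda>j. \<lambda>x\<in>topspace X. max 0 (min 1 (sum_list (map (\<lambda>b. b x) bs) - of_int j))"
  have c: "c \<in> S" using Cons.prems by simp
  have t: "?t i \<in> S" for i using Cons.prems by (intro Cons.IH) simp
  have trunc: "max 0 (min 1 (c + s - j)) =
      min (max 0 (min 1 (s - j)) + max 0 (max 0 (min 1 (s - (j - 1))) + c - 1)) 1"
    if "0 \<le> c \<and> c \<le> 1" for c s j :: real
    using that by (auto simp: min_def max_def)
  have "(\<lambda>x\<in>topspace X. max 0 (min 1 (sum_list (map (\<lambda>b. b x) (c # bs)) - of_int j))) =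
      ?t j \<oplus>\<^bsub>cont_mv X\<^esub> (?t (j - 1) \<odot>\<^bsub>cont_mv X\<^esub> c)"
    using trunc range[OF c] by (simp add: fun_eq_iff)
  then show ?case by (simp only: plus_mem[OF t times_mem[OF t c]])
qed

text \<open>Membership in the hull asks for exactly \<open>n\<close> summands, whereas
  \<open>bs\<close> may have any length. The sum is cut into slices between consecutive integers;
  these lie in \<open>S\<close> by \<open>clamp_sum_mem\<close>, and the first \<open>n\<close> of
  them add up to the truncated sum by \<open>sum_clamp\<close>.\<close>

lemma truncated_mean_mem_hull:
  assumes bs: "set bs \<subseteq> S" and n: "n \<ge> 1"
    and cont: "a \<in> carrier (cont_mv X)"
    and a: "\<And>x. x \<in> topspace X \<Longrightarrow> a x = min 1 (sum_list (map (\<lambda>b. b x) bs) / real n)"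
  shows "a \<in> carrier (divisible_hull X S)"
proof -
  define b where "b i = (\<lambda>x\<in>topspace X. max 0 (min 1 (sum_list (map (\<lambda>b. b x) bs) - of_int (int i - 1))))" for i
  have "a x = (\<Sum>i=1..n. b i x / real n)" if x: "x \<in> topspace X" for x
  proof -
    have "0 \<le> sum_list (map (\<lambda>b. b x) bs)"
      using bs range x by (intro sum_list_nonneg) auto
    then have "(\<Sum>i=1..n. b i x) = min (sum_list (map (\<lambda>b. b x) bs)) (real n)"
      using sum_clamp x by (simp add: b_def)
    then show ?thesis
      using n by (simp add: a[OF x] flip: sum_divide_distrib) (auto simp: min_def field_simps)
  qed
  moreover have "b i \<in> S" for i
    unfolding b_def by (rule clamp_sum_mem[OF bs])
  ultimately show ?thesis
    using n cont unfolding mem_divisible_hull_iff by blast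
qed

lemma hull_mean:
  assumes "a \<in> carrier (divisible_hull X S)"
  obtains bs n where "set bs \<subseteq> S" "n \<ge> 1"
    "\<And>x. x \<in> topspace X \<Longrightarrow> real n * a x = sum_list (map (\<lambda>b. b x) bs)"
proof -
  obtain n b where n: "n \<ge> 1" and b: "\<forall>i\<in>{1..n}. b i \<in> S"
    and a: "\<forall>x\<in>topspace X. a x = (\<Sum>i=1..n. b i x / real n)"
    using assms unfolding mem_divisible_hull_iff by blast
  show thesis
  proof (rule that)
    show "set (map b [1..<Suc n]) \<subseteq> S" using b by auto
    show "real n * a x = sum_list (map (\<lambda>b. b x) (map b [1..<Suc n]))" if "x \<in> topspace X" for x
    proof -
      have "sum_list (map (\<lambda>b. b x) (map b [1..<Suc n])) = (\<Sum>i\<in>{1..n}. b i x)"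
        by (simp add: o_def interv_sum_list_conv_sum_set_nat atLeastLessThanSuc_atLeastAtMost del: upt_Suc)
      then show ?thesis using a that n by (simp flip: sum_divide_distrib)
    qed
  qed (rule n)
qed

lemma mv_algebra_divisible_hull: "mv_algebra (divisible_hull X S)"
proof -
  interpret C: mv_algebra "cont_mv X" by (rule mv_algebra_cont_mv)
  let ?D = "carrier (divisible_hull X S)"
  have sub: "?D \<subseteq> carrier (cont_mv X)" by (auto simp: mem_divisible_hull_iff)
  have "mv_algebra ((cont_mv X)\<lparr>carrier := ?D\<rparr>)"
  proof (rule mv_algebra_subalgebra[OF mv_algebra_cont_mv sub])
    show "\<zero>\<^bsub>cont_mv X\<^esub> \<in> ?D"
      by (rule truncated_mean_mem_hull[of "[]" 1]) (use C.zero_closed in auto)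
  next
    \<comment> \<open>Negation keeps the number of summands: \<open>1 - a\<close> is the mean of the
      \<open>1 - b i\<close>.\<close>
    fix a assume a: "a \<in> ?D"
    then obtain n b where n: "n \<ge> 1" and b: "\<forall>i\<in>{1..n}. b i \<in> S"
      and eq: "\<forall>x\<in>topspace X. a x = (\<Sum>i=1..n. b i x / real n)"
      unfolding mem_divisible_hull_iff by blast
    have "(\<sim>\<^bsub>cont_mv X\<^esub> a) x = (\<Sum>i=1..n. (\<sim>\<^bsub>cont_mv X\<^esub> (b i)) x / real n)"
      if "x \<in> topspace X" for x
      using that eq n by (simp add: diff_divide_distrib sum_subtractf)
    moreover have "\<sim>\<^bsub>cont_mv X\<^esub> a \<in> carrier (cont_mv X)" using C.neg_closed a sub by blast
    ultimately show "\<sim>\<^bsub>cont_mv X\<^esub> a \<in> ?D"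
      using n b neg_mem unfolding mem_divisible_hull_iff
      by (intro conjI exI[of _ n] exI[of _ "\<lambda>i. \<sim>\<^bsub>cont_mv X\<^esub> (b i)"]) blast+
  next
    fix a c assume a: "a \<in> ?D" and c: "c \<in> ?D"
    obtain as n where as: "set as \<subseteq> S" "n \<ge> 1"
      "\<And>x. x \<in> topspace X \<Longrightarrow> real n * a x = sum_list (map (\<lambda>b. b x) as)"
      by (rule hull_mean[OF a]) blast
    obtain cs m where cs: "set cs \<subseteq> S" "m \<ge> 1"
      "\<And>x. x \<in> topspace X \<Longrightarrow> real m * c x = sum_list (map (\<lambda>b. b x) cs)"
      by (rule hull_mean[OF c]) blast
    show "a \<oplus>\<^bsub>cont_mv X\<^esub> c \<in> ?D"
    \<comment> \<open>Over the common denominator \<open>n * m\<close> the summands of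
      \<open>a\<close> occur \<open>m\<close> times and those of \<open>c\<close> occur
      \<open>n\<close> times.\<close>
    proof (rule truncated_mean_mem_hull[of "concat (replicate m as) @ concat (replicate n cs)" "n * m"])
      show "a \<oplus>\<^bsub>cont_mv X\<^esub> c \<in> carrier (cont_mv X)" using C.plus_closed a c sub by blast
      fix x assume x: "x \<in> topspace X"
      let ?s = "sum_list (map (\<lambda>b. b x) (concat (replicate m as) @ concat (replicate n cs)))"
      have "?s = real (n * m) * (a x + c x)"
        by (simp add: sum_list_concat_replicate as(3)[OF x, symmetric] cs(3)[OF x, symmetric] algebra_simps)
      then show "(a \<oplus>\<^bsub>cont_mv X\<^esub> c) x = min 1 (?s / real (n * m))"
        using x as(2) cs(2) by (simp add: min.commute)
    qed (use as cs in auto)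
  qed
  then show ?thesis by (simp add: divisible_hull_def)
qed

lemma hull_subset: "carrier (divisible_hull X S) \<subseteq> carrier (cont_mv X)"
  by (auto simp: mem_divisible_hull_iff)

lemma hull_inclusion_hom: "(\<lambda>f. f) \<in> mv_hom (divisible_hull X S) (cont_mv X)"
  using hull_subset by (auto simp: mv_hom_def divisible_hull_def)

text \<open>For \<open>q = m / n\<close>, divide the sum of \<open>m\<close> copies of
  \<open>b\<close> by \<open>n\<close>.\<close>

lemma rat_scale_mem_hull:
  assumes q: "q \<in> {0..1} \<inter> \<rat>" and b: "b \<in> S"
  shows "(\<lambda>x\<in>topspace X. q * b x) \<in> carrier (divisible_hull X S)"
proof -
  obtain m n :: nat where n: "n \<noteq> 0" and mn: "q = real m / real n"
    using Rats_abs_nat_div_natE[of q] q by (metis IntE abs_of_nonneg atLeastAtMost_iff)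
  show ?thesis
  proof (rule truncated_mean_mem_hull[of "replicate m b" n])
    show "(\<lambda>x\<in>topspace X. q * b x) \<in> carrier (cont_mv X)"
      using b subset q range[OF b]
      by (intro restrict_mem_cont_mv) (auto simp: mem_cont_mv_iff mult_le_one intro!: continuous_intros)
    show "(\<lambda>x\<in>topspace X. q * b x) x = min 1 (sum_list (map (\<lambda>b. b x) (replicate m b)) / real n)"
      if "x \<in> topspace X" for x
    proof -
      have "q * b x \<le> 1" using q range[OF b that] by (auto intro: mult_le_one)
      then show ?thesis using that by (simp add: mn sum_list_replicate)
    qed
  qed (use b n in auto)
qed

end

section \<open>The tensor product with the rational unit interval\<close>

text \<open>By additivity, \<open>\<beta> (m/n) a = m * \<beta> (1/n) a\<close>.\<close>

lemma rat_bimorphism_eq: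
  assumes bi: "mv_bimorphism rat_unit_mv A unit_mv \<beta>" and q: "q \<in> {0..1} \<inter> \<rat>" and a: "a \<in> carrier A"
  shows "\<beta> q a = q * \<beta> 1 a"
proof -
  have range: "\<beta> q a \<in> {0..1}" if "q \<in> {0..1} \<inter> \<rat>" for q
    using bi that a by (auto simp: mv_bimorphism_def)
  have add: "\<beta> (q + r) a = \<beta> q a + \<beta> r a" if "q \<in> {0..1} \<inter> \<rat>" "r \<in> {0..1} \<inter> \<rat>" "q + r \<le> 1" for q r
  proof -
    \<comment> \<open>The first conjunct says that the sum is defined, so the truncation in the
      second has no effect.\<close>
    have "max 0 (\<beta> q a + \<beta> r a - 1) = 0 \<and> \<beta> (min (q + r) 1) a = min (\<beta> q a + \<beta> r a) 1"
      using bi a that unfolding mv_bimorphism_def mv_linear_def by auto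
    then show ?thesis using that by (simp add: min_def max_def split: if_splits)
  qed
  obtain m n :: nat where n: "n \<noteq> 0" and mn: "q = real m / real n"
    using Rats_abs_nat_div_natE[of q] q by (metis IntE abs_of_nonneg atLeastAtMost_iff)
  have mult: "\<beta> (real k / real n) a = real k * \<beta> (1 / real n) a" if "k \<le> n" for k
    using that
  proof (induction k)
    case 0
    then show ?case using add[of 0 0] by simp
  next
    case (Suc k)
    have "real (Suc k) / real n = real k / real n + 1 / real n"
      by (simp add: add_divide_distrib)
    moreover have "\<beta> (real k / real n + 1 / real n) a = \<beta> (real k / real n) a + \<beta> (1 / real n) a"
      using Suc.prems n by (intro add) (auto simp: field_simps)
    ultimately show ?case using Suc by (simp add: algebra_simps)
  qed
  have "m \<le> n" using q n by (auto simp: mn field_simps)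
  \<comment> \<open>The case \<open>k = n\<close> evaluates \<open>\<beta> (1 / n) a\<close> as
    \<open>\<beta> 1 a / n\<close>.\<close>
  then show ?thesis using mult[of m] mult[of n] n by (simp add: mn)
qed

text \<open>Negation is preserved because \<open>a\<close> and \<open>\<sim> a\<close> have the
  defined sum \<open>\<one>\<close>, which goes to 1. A general sum is first rewritten by
  \<open>plus_neg_meet\<close> as a defined one, to which additivity, meets and negation
  apply.\<close>

lemma bimorphism_one_hom:
  fixes A :: "('a, 'm) mv_scheme" (structure)
  assumes A: "mv_algebra A" and bi: "mv_bimorphism rat_unit_mv A unit_mv \<beta>"
  shows "\<beta> 1 \<in> mv_hom A unit_mv"
proof -
  interpret mv_algebra A by fact
  have range: "0 \<le> \<beta> 1 a \<and> \<beta> 1 a \<le> 1" if "a \<in> carrier A" for a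
    using bi that by (auto simp: mv_bimorphism_def)
  have lin: "mv_linear A unit_mv (\<beta> 1)" and one: "\<beta> 1 \<one> = 1"
    using bi by (auto simp: mv_bimorphism_def)
  have meet: "\<beta> 1 (a \<sqinter> b) = min (\<beta> 1 a) (\<beta> 1 b)" if "a \<in> carrier A" "b \<in> carrier A" for a b
    using lin that range by (simp add: mv_linear_def)
  have add: "\<beta> 1 (a \<oplus> b) = \<beta> 1 a + \<beta> 1 b"
    if "a \<in> carrier A" "b \<in> carrier A" "a \<odot> b = \<zero>" for a b
  proof -
    have "max 0 (\<beta> 1 a + \<beta> 1 b - 1) = 0 \<and> \<beta> 1 (a \<oplus> b) = min (\<beta> 1 a + \<beta> 1 b) 1"
      using lin that unfolding mv_linear_def by auto
    then show ?thesis by (simp add: min_def max_def split: if_splits)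
  qed
  have neg: "\<beta> 1 (\<sim> a) = 1 - \<beta> 1 a" if "a \<in> carrier A" for a
    using add[of a "\<sim> a"] that one by simp
  have "\<beta> 1 (a \<oplus> b) = min (\<beta> 1 a + \<beta> 1 b) 1" if [simp]: "a \<in> carrier A" "b \<in> carrier A" for a b
  proof -
    have "a \<odot> (b \<sqinter> \<sim> a) = \<zero>"
      using times_eq_zero_iff[of "b \<sqinter> \<sim> a" a] meet_le2[of b "\<sim> a"] by (simp add: times_comm)
    then have "\<beta> 1 (a \<oplus> (b \<sqinter> \<sim> a)) = \<beta> 1 a + min (\<beta> 1 b) (1 - \<beta> 1 a)"
      by (simp add: add meet neg)
    then show ?thesis by (simp add: plus_neg_meet min_def split: if_splits)
  qed
  moreover have "\<beta> 1 \<zero> = 0" using neg[of \<one>] one by simp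
  ultimately show ?thesis using range neg by (simp add: mv_hom_def)
qed

lemma cont_subalgebra_image:
  assumes A: "mv_algebra A" and e: "e \<in> mv_hom A (cont_mv X)"
  shows "cont_subalgebra X (e ` carrier A)"
proof -
  interpret mv_algebra A by fact
  note ee = mv_homD[OF e]
  show ?thesis
  proof
    show "e ` carrier A \<subseteq> carrier (cont_mv X)" using ee(1) by blast
    show "\<zero>\<^bsub>cont_mv X\<^esub> \<in> e ` carrier A" using ee(4) zero_closed by (metis image_eqI)
    show "\<sim>\<^bsub>cont_mv X\<^esub> f \<in> e ` carrier A" if "f \<in> e ` carrier A" for f
      using that ee(3) neg_closed by (metis (no_types, lifting) imageE image_eqI)
    show "f \<oplus>\<^bsub>cont_mv X\<^esub> g \<in> e ` carrier A" if "f \<in> e ` carrier A" "g \<in> e ` carrier A" for f g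
      using that ee(2) plus_closed by (metis (no_types, lifting) imageE image_eqI)
  qed
qed

text \<open>A nonnegative factor commutes with maxima and minima, and a factor of at most 1 keeps
  sums below 1. Each argument in turn is the factor for the other.\<close>

lemma scale_bimorphism:
  assumes A: "mv_algebra A" and e: "e \<in> mv_hom A (cont_mv X)"
  shows "mv_bimorphism rat_unit_mv A (divisible_hull X (e ` carrier A))
    (\<lambda>q a. \<lambda>x\<in>topspace X. q * e a x)"
proof -
  interpret mv_algebra A by fact
  interpret S: cont_subalgebra X "e ` carrier A" by (rule cont_subalgebra_image[OF A e])
  note ee = mv_homD[OF e] mv_hom_derived[OF A e]
  let ?\<beta> = "\<lambda>q a. \<lambda>x\<in>topspace X. q * e a x"
  have mem: "?\<beta> q a \<in> carrier (divisible_hull X (e ` carrier A))"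
    if "q \<in> {0..1} \<inter> \<rat>" "a \<in> carrier A" for q a
    using that by (intro S.rat_scale_mem_hull) auto
  have mem': "?\<beta> q a \<in> carrier (cont_mv X)" if "q \<in> {0..1} \<inter> \<rat>" "a \<in> carrier A" for q a
    using mem[OF that] S.hull_subset by blast
  have range: "0 \<le> e a x \<and> e a x \<le> 1" if "a \<in> carrier A" "x \<in> topspace X" for a x
    using S.range that by blast
  have max_l: "max q r * y = max (q * y) (r * y)" and min_l: "min q r * y = min (q * y) (r * y)"
    if "0 \<le> y" for q r y :: real
    using that by (auto simp: max_mult_distrib_right min_mult_distrib_right)
  have max_r: "y * max q r = max (y * q) (y * r)" and min_r: "y * min q r = min (y * q) (y * r)"
    if "0 \<le> y" for q r y :: real
    using that by (auto simp: max_mult_distrib_left min_mult_distrib_left)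
  have sum_l: "q * y + r * y \<le> 1" if "q + r \<le> 1" "0 \<le> y" "y \<le> 1" for q r y :: real
    using mult_right_mono[OF that(1,2)] that(3) by (simp add: distrib_right)
  have sum_r: "q * y + q * z \<le> 1" if "y + z \<le> 1" "0 \<le> q" "q \<le> 1" for q y z :: real
    using sum_l[OF that] by (simp add: mult.commute)
  have lin1: "mv_linear rat_unit_mv (divisible_hull X (e ` carrier A)) (\<lambda>q. ?\<beta> q a)"
    if a: "a \<in> carrier A" for a
    unfolding mv_linear_def divisible_hull_ops
  proof (intro ballI conjI impI)
    fix q r assume "q \<in> carrier rat_unit_mv" "r \<in> carrier rat_unit_mv"
    then have q: "q \<in> {0..1} \<inter> \<rat>" and r: "r \<in> {0..1} \<inter> \<rat>" by simp_all
    show "?\<beta> (q \<squnion>\<^bsub>rat_unit_mv\<^esub> r) a = ?\<beta> q a \<squnion>\<^bsub>cont_mv X\<^esub> ?\<beta> r a"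
      unfolding cont_mv_lattice[OF mem'[OF q a] mem'[OF r a]]
      using q r range[OF a] by (auto simp: fun_eq_iff max_l)
    show "?\<beta> (q \<sqinter>\<^bsub>rat_unit_mv\<^esub> r) a = ?\<beta> q a \<sqinter>\<^bsub>cont_mv X\<^esub> ?\<beta> r a"
      unfolding cont_mv_lattice[OF mem'[OF q a] mem'[OF r a]]
      using q r range[OF a] by (auto simp: fun_eq_iff min_l)
    assume "q \<odot>\<^bsub>rat_unit_mv\<^esub> r = \<zero>\<^bsub>rat_unit_mv\<^esub>"
    then have le: "q + r \<le> 1" by simp
    show "?\<beta> q a \<odot>\<^bsub>cont_mv X\<^esub> ?\<beta> r a = \<zero>\<^bsub>cont_mv X\<^esub>"
      using sum_l[OF le] range[OF a] by (auto simp: fun_eq_iff)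
    show "?\<beta> (q \<oplus>\<^bsub>rat_unit_mv\<^esub> r) a = ?\<beta> q a \<oplus>\<^bsub>cont_mv X\<^esub> ?\<beta> r a"
      using le sum_l[OF le] range[OF a] by (auto simp: fun_eq_iff distrib_right)
  qed
  have lin2: "mv_linear A (divisible_hull X (e ` carrier A)) (?\<beta> q)" if q: "q \<in> {0..1} \<inter> \<rat>" for q
    unfolding mv_linear_def divisible_hull_ops
  proof (intro ballI conjI impI)
    fix a b assume a: "a \<in> carrier A" and b: "b \<in> carrier A"
    show "?\<beta> q (a \<squnion>\<^bsub>A\<^esub> b) = ?\<beta> q a \<squnion>\<^bsub>cont_mv X\<^esub> ?\<beta> q b"
      unfolding cont_mv_lattice[OF mem'[OF q a] mem'[OF q b]] ee(7)[OF a b]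
        cont_mv_lattice[OF ee(1)[OF a] ee(1)[OF b]]
      using q by (auto simp: fun_eq_iff max_r)
    show "?\<beta> q (a \<sqinter>\<^bsub>A\<^esub> b) = ?\<beta> q a \<sqinter>\<^bsub>cont_mv X\<^esub> ?\<beta> q b"
      unfolding cont_mv_lattice[OF mem'[OF q a] mem'[OF q b]] ee(8)[OF a b]
        cont_mv_lattice[OF ee(1)[OF a] ee(1)[OF b]]
      using q by (auto simp: fun_eq_iff min_r)
    assume "a \<odot>\<^bsub>A\<^esub> b = \<zero>\<^bsub>A\<^esub>"
    then have "e a \<odot>\<^bsub>cont_mv X\<^esub> e b = \<zero>\<^bsub>cont_mv X\<^esub>"
      using ee(4,6) a b by metis
    then have le: "e a x + e b x \<le> 1" if "x \<in> topspace X" for x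
      using that by (auto simp: fun_eq_iff max_def split: if_splits)
    show "?\<beta> q a \<odot>\<^bsub>cont_mv X\<^esub> ?\<beta> q b = \<zero>\<^bsub>cont_mv X\<^esub>"
      using sum_r[OF le] q by (auto simp: fun_eq_iff)
    show "?\<beta> q (a \<oplus>\<^bsub>A\<^esub> b) = ?\<beta> q a \<oplus>\<^bsub>cont_mv X\<^esub> ?\<beta> q b"
      using le sum_r[OF le] q by (auto simp: fun_eq_iff ee(2)[OF a b] distrib_left)
  qed
  have "?\<beta> 1 \<one>\<^bsub>A\<^esub> = \<one>\<^bsub>cont_mv X\<^esub>"
    by (simp add: ee(5) fun_eq_iff)
  then show ?thesis
    unfolding mv_bimorphism_def divisible_hull_ops using mem lin1 lin2 by simp
qed


theorem rational_tensor_isomorphic_hull: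
  assumes A: "mv_algebra A" and rep: "mv_representation A X e"
  shows "mv_isomorphic (semisimple_tensor rat_unit_mv A) (divisible_hull X (e ` carrier A))"
proof -
  have e: "e \<in> mv_hom A (cont_mv X)" using rep by (simp add: mv_representation_def)
  interpret A: mv_algebra A by fact
  interpret S: cont_subalgebra X "e ` carrier A" by (rule cont_subalgebra_image[OF A e])
  note ee = mv_homD[OF e] mv_hom_derived[OF A e]
  let ?T = "mv_tensor rat_unit_mv A" and ?D = "divisible_hull X (e ` carrier A)"
  let ?p = "pure_tensor rat_unit_mv A"
  let ?\<beta> = "\<lambda>q a. \<lambda>x\<in>topspace X. q * e a x"
  have D: "mv_algebra ?D" by (rule S.mv_algebra_divisible_hull)
  have T: "mv_algebra ?T" by (rule mv_algebra_mv_tensor[OF mv_algebra_rat_unit_mv A])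
  have p: "mv_bimorphism rat_unit_mv A ?T ?p"
    by (rule mv_bimorphism_pure_tensor[OF mv_algebra_rat_unit_mv A])
  interpret T: mv_algebra ?T by fact
  obtain h where h: "h \<in> mv_hom ?T ?D"
    and hp: "\<And>q a. q \<in> {0..1} \<inter> \<rat> \<Longrightarrow> a \<in> carrier A \<Longrightarrow> h (?p q a) = ?\<beta> q a"
    using mv_tensor_universal[OF mv_algebra_rat_unit_mv A D scale_bimorphism[OF A e]] by auto
  note hh = mv_homD[OF h]
  have hX: "(\<lambda>t. h t x) \<in> mv_hom ?T unit_mv" if "x \<in> topspace X" for x
    using mv_hom_compose[OF mv_hom_compose[OF h S.hull_inclusion_hom] eval_cont_mv_hom[OF that]]
    by (simp add: o_def)
  have pc: "?p q a \<in> carrier ?T" if "q \<in> {0..1} \<inter> \<rat>" "a \<in> carrier A" for q a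
    using p that by (simp add: mv_bimorphism_def)
  have ext: "f = g" if "f \<in> carrier ?D" "g \<in> carrier ?D" "\<And>x. x \<in> topspace X \<Longrightarrow> f x = g x" for f g
    using that S.hull_subset by (intro extensionalityI[of f "topspace X"]) (auto simp: mem_cont_mv_iff)
  have "d \<in> h ` carrier ?T" if d: "d \<in> carrier ?D" for d
  proof -
    obtain n b where n: "n \<ge> 1" and b: "\<forall>i\<in>{1..n}. b i \<in> e ` carrier A"
      and deq: "\<forall>x\<in>topspace X. d x = (\<Sum>i=1..n. b i x / real n)"
      using d unfolding mem_divisible_hull_iff by blast
    \<comment> \<open>The bound \<open>k \<le> n\<close> keeps the partial sums at most 1, so
      \<oplus> is the addition of reals at every stage.\<close>
    have "\<exists>t\<in>carrier ?T. \<forall>x\<in>topspace X. h t x = (\<Sum>i=1..k. b i x / real n)" if "k \<le> n" for k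
      using that
    proof (induction k)
      case 0
      then show ?case using hh(4) T.zero_closed by (intro bexI[of _ "\<zero>\<^bsub>?T\<^esub>"]) auto
    next
      case (Suc k)
      then obtain t where t: "t \<in> carrier ?T" "\<forall>x\<in>topspace X. h t x = (\<Sum>i=1..k. b i x / real n)"
        by auto
      obtain a where a: "a \<in> carrier A" "b (Suc k) = e a" using b Suc.prems by force
      have q: "1 / real n \<in> {0..1} \<inter> \<rat>" using n by auto
      let ?t = "t \<oplus>\<^bsub>?T\<^esub> ?p (1 / real n) a"
      have "h ?t x = (\<Sum>i=1..Suc k. b i x / real n)" if x: "x \<in> topspace X" for x
      proof -
        have "(\<Sum>i=1..Suc k. b i x / real n) \<le> (\<Sum>i=1..Suc k. 1 / real n)"
          using b Suc.prems S.range x by (intro sum_mono divide_right_mono) auto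
        also have "\<dots> \<le> 1" using Suc.prems n by (simp add: field_simps)
        finally show ?thesis
          using x t hh(2)[OF t(1) pc[OF q a(1)]] by (simp add: hp[OF q a(1)] a(2))
      qed
      then show ?case using T.plus_closed[OF t(1) pc[OF q a(1)]] by blast
    qed
    then obtain t where t: "t \<in> carrier ?T" "\<forall>x\<in>topspace X. h t x = (\<Sum>i=1..n. b i x / real n)"
      by blast
    have "h t = d" using t deq by (intro ext[OF hh(1)[OF t(1)] d]) simp
    then show ?thesis using t(1) by blast
  qed
  then have surj: "h ` carrier ?T = carrier ?D" using hh(1) by blast
  have zero: "h t = \<zero>\<^bsub>?D\<^esub> \<longleftrightarrow> (\<forall>x\<in>topspace X. h t x = 0)" if "t \<in> carrier ?T" for t
    using ext[OF hh(1)[OF that] hh(1)[OF T.zero_closed]] hh(4) by auto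
  have "mv_radical ?T = {t \<in> carrier ?T. h t = \<zero>\<^bsub>?D\<^esub>}"
  proof (intro equalityI subsetI)
    fix t assume t: "t \<in> mv_radical ?T"
    \<comment> \<open>Evaluation at \<open>x\<close> after \<open>h\<close> is a homomorphism to
      [0,1], so its kernel is one of the maximal ideals.\<close>
    then have "h t x = 0" if "x \<in> topspace X" for x
      using T.hom_kernel_maximal[OF hX[OF that]] unfolding mv_radical_def by blast
    then show "t \<in> {t \<in> carrier ?T. h t = \<zero>\<^bsub>?D\<^esub>}" using t zero by (simp add: mv_radical_def)
  next
    fix t assume "t \<in> {t \<in> carrier ?T. h t = \<zero>\<^bsub>?D\<^esub>}"
    then have t: "t \<in> carrier ?T" and t0: "\<forall>x\<in>topspace X. h t x = 0" using zero by auto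
    have "t \<in> M" if M: "mv_maximal_ideal ?T M" for M
    proof -
      obtain f where f: "f \<in> mv_hom ?T unit_mv" and Mf: "M = {x \<in> carrier ?T. f x = 0}"
        using T.maximal_ideal_hom_kernel[OF M] .
      let ?\<gamma> = "\<lambda>q a. f (?p q a)"
      have bi: "mv_bimorphism rat_unit_mv A unit_mv ?\<gamma>" by (rule mv_bimorphism_compose[OF T p f])
      obtain x where x: "x \<in> topspace X" "\<And>a. a \<in> carrier A \<Longrightarrow> f (?p 1 a) = e a x"
        by (rule hom_is_evaluation[OF A rep bimorphism_one_hom[OF A bi]]) blast
      \<comment> \<open>Uniqueness in the universal property: \<open>f\<close> and the evaluation of
        \<open>h\<close> at \<open>x\<close> agree with \<open>?\<gamma>\<close> on pure tensors, so
        both coincide with \<open>g\<close>.\<close>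
      obtain g where g: "\<forall>f'\<in>mv_hom ?T unit_mv.
          (\<forall>q\<in>carrier rat_unit_mv. \<forall>a\<in>carrier A. f' (?p q a) = ?\<gamma> q a) \<longrightarrow>
          (\<forall>t\<in>carrier ?T. f' t = g t)"
        using mv_tensor_universal[OF mv_algebra_rat_unit_mv A mv_algebra_unit_mv bi] by blast
      have "h (?p q a) x = ?\<gamma> q a" if "q \<in> {0..1} \<inter> \<rat>" "a \<in> carrier A" for q a
        using rat_bimorphism_eq[OF bi that] that x hp[OF that] by simp
      then have "h t x = g t" using bspec[OF g hX[OF x(1)]] t by simp
      moreover have "f t = g t" using bspec[OF g f] t by simp
      ultimately have "f t = h t x" by simp
      then show ?thesis using t t0 x(1) by (simp add: Mf)
    qed
    then show "t \<in> mv_radical ?T" using t by (simp add: mv_radical_def)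
  qed
  then show ?thesis
    unfolding semisimple_tensor_def by (rule mv_isomorphic_quotient[OF T D h surj])
qed

text \<open>The hull depends on a chosen embedding, so the isomorphism is stated for every embedding
  over an arbitrary point type \<open>'x\<close>. The first conjunct supplies one, whose points are
  homomorphisms and thus have type \<open>'a \<Rightarrow> real\<close>.\<close>

theorem corollary3p2:
  fixes A :: "('a, 'm) mv_scheme"
  assumes "mv_algebra A" and "mv_semisimple A"
  shows "(\<exists>(X :: ('a \<Rightarrow> real) topology) e. mv_representation A X e) \<and>
    (\<forall>(X :: 'x topology) e. mv_representation A X e \<longrightarrow>
       mv_isomorphic (semisimple_tensor rat_unit_mv A) (divisible_hull X (e ` carrier A)))"
  using mv_representation_exists[OF assms] rational_tensor_isomorphic_hull[OF assms(1)] by blast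

end
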